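(* For any point $P$ not on the sides of $ABC$ or $K^{-1}(ABC)$, we have $\gamma_P(l_\infty)=\tilde{\mathcal{C}}_O$.
   Context: We work in the Euclidean plane extended by its line at infinity $l_\infty$; points not on $l_\infty$ are called ordinary, and affine maps are extended to $l_\infty$. $ABC$ is an ordinary non-degenerate triangle; its sides are the lines $BC, CA, AB$. $X_1X_2\cdot Y_1Y_2$ denotes the intersection of two lines. $K$ is the complement map (homothety with center the centroid $G$ and ratio $-1/2$); $K^{-1}(ABC)$ is the anticomplementary triangle. $\iota$ is the isotomic map, $(x:y:z)\mapsto(1/x:1/y:1/z)$ in barycentric coordinates. For $P$ (ordinary or infinite) not on the sides of $ABC$ or $K^{-1}(ABC)$ put $P'=\iota(P)$, $Q=K(P')$; let $D=AP\cdot BC$, $E=BP\cdot CA$, $F=CP\cdot AB$ (cevian triangle of $P$) and let $D_3E_3F_3$ be the cevian triangle of $P'$. Generalized isogonal map $\gamma_P$: let $h_a$ be the affine reflection about the line $AQ$ in the direction of $EF$ (i.e. $h_a(X)=X'$ with $XX'\parallel EF$ and the midpoint of $XX'$ on $AQ$), $h_b$ the affine reflection about $BQ$ in the direction $DF$, and $h_c$ the affine reflection about $CQ$ in the direction $DE$. For $X\neq A,B,C$, $\gamma_P(X)$ is the common point of the lines $Ah_a(X),Bh_b(X),Ch_c(X)$ (which are concurrent). The circumconic $\tilde{\mathcal{C}}_O$: let $T_{P'}$ be the affine map taking $A,B,C$ to $D_3,E_3,F_3$, and let $\mathcal{N}_{P'}$ be the nine-point conic of the quadrangle $ABCP'$ with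 respect to $l_\infty$, i.e. the locus of poles of $l_\infty$ with respect to the conics through $A,B,C,P'$; it passes through the diagonal points $D_3,E_3,F_3$ and through the midpoint of each side of the quadrangle (the midpoint of a side with one vertex at infinity being that infinite vertex). Then $\tilde{\mathcal{C}}_O=T_{P'}^{-1}(\mathcal{N}_{P'})$; it is a conic through $A,B,C$ with center $O=T_{P'}^{-1}(K(Q))$. *)

theory Defs
  imports "HOL-Analysis.Analysis"
begin

section \<open>The Euclidean plane extended by its line at infinity\<close>

text \<open>
  Points of the extended plane are the one-dimensional subspaces of \<open>\<real>\<^sup>2 \<times> \<real>\<close>
  (homogeneous coordinates). The ordinary point \<open>X\<close> is the span of \<open>(X, 1)\<close>;
  the infinite point of direction \<open>d \<noteq> 0\<close> is the span of \<open>(d, 0)\<close>.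
\<close>

typedef ppoint = "{S :: ((real^2) \<times> real) set. subspace S \<and> dim S = 1}"
  morphisms rays Abs_ppoint
proof -
  have "dim (span {(0 :: real^2, 1 :: real)}) = 1"
    by (simp add: dim_insert zero_prod_def)
  then show ?thesis
    using subspace_span by blast
qed

definition hom :: "(real^2) \<times> real \<Rightarrow> ppoint" where
  "hom v = Abs_ppoint (span {v})"

definition ordinary :: "real^2 \<Rightarrow> ppoint" where
  "ordinary X = hom (X, 1)"

definition line_at_infinity :: "ppoint set" where
  "line_at_infinity = {X. \<forall>v \<in> rays X. snd v = 0}"

text \<open>The line through two distinct points (for \<open>X = Y\<close> this is just \<open>{X}\<close>).\<close>

definition join :: "ppoint \<Rightarrow> ppoint \<Rightarrow> ppoint set" where
  "join X Y = {Z. rays Z \<subseteq> span (rays X \<union> rays Y)}"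

definition meet :: "ppoint set \<Rightarrow> ppoint set \<Rightarrow> ppoint" where
  "meet l m = (THE Z. Z \<in> l \<and> Z \<in> m)"


section \<open>Affine maps\<close>

definition affine_map :: "(real^2 \<Rightarrow> real^2) \<Rightarrow> bool" where
  "affine_map f \<longleftrightarrow> (\<exists>g b. linear g \<and> f = (\<lambda>X. g X + b))"

text \<open>
  Extension of a bijective affine map \<open>X \<mapsto> g X + b\<close> to the extended plane. Here
  \<open>b = f 0\<close> and \<open>g v = f v - f 0\<close>, so that \<open>(X, 1)\<close> goes to \<open>(f X, 1)\<close> and
  \<open>(d, 0)\<close> to \<open>(g d, 0)\<close>.
\<close>

definition affine_ext :: "(real^2 \<Rightarrow> real^2) \<Rightarrow> ppoint \<Rightarrow> ppoint" where
  "affine_ext f X = Abs_ppoint ((\<lambda>(v, w). (f v - f 0 + w *\<^sub>R f 0, w)) ` rays X)"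

text \<open>
  The affine reflection about the line \<open>l\<close> in the direction of the infinite point \<open>d\<close>
  (not on \<open>l\<close>): \<open>X X'\<close> passes through \<open>d\<close> and the midpoint of \<open>X X'\<close> is on \<open>l\<close>.
\<close>

definition affine_reflection :: "ppoint set \<Rightarrow> ppoint \<Rightarrow> real^2 \<Rightarrow> real^2" where
  "affine_reflection l d X =
     (THE X'. ordinary X' \<in> join (ordinary X) d \<and> ordinary (midpoint X X') \<in> l)"


section \<open>Cevian geometry of a triangle\<close>

definition complement_map :: "real^2 \<Rightarrow> real^2 \<Rightarrow> real^2 \<Rightarrow> real^2 \<Rightarrow> real^2" where
  "complement_map A B C X =
     (let G = (1/3) *\<^sub>R (A + B + C) in G + (-1/2) *\<^sub>R (X - G))"

definition on_sides :: "real^2 \<Rightarrow> real^2 \<Rightarrow> real^2 \<Rightarrow> ppoint set" where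
  "on_sides A B C = join (ordinary B) (ordinary C) \<union> join (ordinary C) (ordinary A)
                      \<union> join (ordinary A) (ordinary B)"

definition on_sides_anticomplementary :: "real^2 \<Rightarrow> real^2 \<Rightarrow> real^2 \<Rightarrow> ppoint set" where
  "on_sides_anticomplementary A B C =
     (let Kinv = inv (complement_map A B C) in on_sides (Kinv A) (Kinv B) (Kinv C))"

text \<open>The point with homogeneous barycentric coordinates \<open>(x : y : z)\<close> with respect to \<open>ABC\<close>.\<close>

definition bary :: "real^2 \<Rightarrow> real^2 \<Rightarrow> real^2 \<Rightarrow> real \<Rightarrow> real \<Rightarrow> real \<Rightarrow> ppoint" where
  "bary A B C x y z = hom (x *\<^sub>R A + y *\<^sub>R B + z *\<^sub>R C, x + y + z)"

definition isotomic :: "real^2 \<Rightarrow> real^2 \<Rightarrow> real^2 \<Rightarrow> ppoint \<Rightarrow> ppoint" where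
  "isotomic A B C P =
     (THE R. \<exists>x y z. x \<noteq> 0 \<and> y \<noteq> 0 \<and> z \<noteq> 0 \<and>
        P = bary A B C x y z \<and> R = bary A B C (1/x) (1/y) (1/z))"

text \<open>\<open>A P \<cdot> B C\<close>, the vertex on \<open>BC\<close> of the cevian triangle of \<open>P\<close>.\<close>

definition cevian_foot :: "real^2 \<Rightarrow> real^2 \<Rightarrow> real^2 \<Rightarrow> ppoint \<Rightarrow> ppoint" where
  "cevian_foot A B C P = meet (join (ordinary A) P) (join (ordinary B) (ordinary C))"

text \<open>
  The generalized isogonal map \<open>\<gamma>\<^sub>P\<close>, as the common point of \<open>A h\<^sub>a(X)\<close>, \<open>B h\<^sub>b(X)\<close>,
  \<open>C h\<^sub>c(X)\<close>. It is meaningful for \<open>X\<close> different from \<open>A\<close>, \<open>B\<close>, \<open>C\<close>.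
\<close>

definition gen_isogonal :: "real^2 \<Rightarrow> real^2 \<Rightarrow> real^2 \<Rightarrow> ppoint \<Rightarrow> ppoint \<Rightarrow> ppoint" where
  "gen_isogonal A B C P X =
     (let Q = affine_ext (complement_map A B C) (isotomic A B C P);
          D = cevian_foot A B C P;
          E = cevian_foot B C A P;
          F = cevian_foot C A B P;
          h = (\<lambda>V Y Z. affine_ext
                 (affine_reflection (join (ordinary V) Q) (meet (join Y Z) line_at_infinity)));
          h\<^sub>a = h A E F;
          h\<^sub>b = h B D F;
          h\<^sub>c = h C D E
      in THE Y. Y \<in> join (ordinary A) (h\<^sub>a X) \<and> Y \<in> join (ordinary B) (h\<^sub>b X)
              \<and> Y \<in> join (ordinary C) (h\<^sub>c X))"


section \<open>Conics\<close>

text \<open>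
  A conic, possibly degenerate, is given by a nonzero symmetric bilinear form on
  homogeneous coordinates.
\<close>

definition conic_form :: "((real^2) \<times> real \<Rightarrow> (real^2) \<times> real \<Rightarrow> real) \<Rightarrow> bool" where
  "conic_form \<beta> \<longleftrightarrow> bilinear \<beta> \<and> (\<forall>u v. \<beta> u v = \<beta> v u) \<and> (\<exists>u v. \<beta> u v \<noteq> 0)"

definition conjugate ::
  "((real^2) \<times> real \<Rightarrow> (real^2) \<times> real \<Rightarrow> real) \<Rightarrow> ppoint \<Rightarrow> ppoint \<Rightarrow> bool" where
  "conjugate \<beta> X Y \<longleftrightarrow> (\<forall>u \<in> rays X. \<forall>v \<in> rays Y. \<beta> u v = 0)"

definition conic ::
  "((real^2) \<times> real \<Rightarrow> (real^2) \<times> real \<Rightarrow> real) \<Rightarrow> ppoint set" where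
  "conic \<beta> = {X. conjugate \<beta> X X}"

text \<open>
  \<open>X\<close> is a pole of the line \<open>l\<close> if it is conjugate to every point of \<open>l\<close>. For a pair of
  lines, the double point is thus a pole of every line; this is how the diagonal points
  of a quadrangle get onto its nine-point conic.
\<close>

definition is_pole_of ::
  "((real^2) \<times> real \<Rightarrow> (real^2) \<times> real \<Rightarrow> real) \<Rightarrow> ppoint \<Rightarrow> ppoint set \<Rightarrow> bool" where
  "is_pole_of \<beta> X l \<longleftrightarrow> (\<forall>Y \<in> l. conjugate \<beta> X Y)"

definition nine_point_conic ::
  "ppoint \<Rightarrow> ppoint \<Rightarrow> ppoint \<Rightarrow> ppoint \<Rightarrow> ppoint set \<Rightarrow> ppoint set" where
  "nine_point_conic A B C D l =
     {X. \<exists>\<beta>. conic_form \<beta> \<and> {A, B, C, D} \<subseteq> conic \<beta> \<and> is_pole_of \<beta> X l}"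

text \<open>The affine map taking \<open>A\<close>, \<open>B\<close>, \<open>C\<close> to the vertices of the cevian triangle of \<open>R\<close>.\<close>

definition cevian_map ::
  "real^2 \<Rightarrow> real^2 \<Rightarrow> real^2 \<Rightarrow> ppoint \<Rightarrow> real^2 \<Rightarrow> real^2" where
  "cevian_map A B C R =
     (THE f. affine_map f \<and> ordinary (f A) = cevian_foot A B C R
        \<and> ordinary (f B) = cevian_foot B C A R \<and> ordinary (f C) = cevian_foot C A B R)"

definition circumconic_O :: "real^2 \<Rightarrow> real^2 \<Rightarrow> real^2 \<Rightarrow> ppoint \<Rightarrow> ppoint set" where
  "circumconic_O A B C P =
     (let P' = isotomic A B C P
      in affine_ext (cevian_map A B C P') -`
           nine_point_conic (ordinary A) (ordinary B) (ordinary C) P' line_at_infinity)"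

end

theory Submission
  imports Defs
begin

text \<open>
  Everything is computed in homogeneous barycentric coordinates with respect to \<open>ABC\<close>. Write
  \<open>P' = (a : b : c)\<close>, so that \<open>P = (1/a : 1/b : 1/c)\<close> with \<open>a, b, c \<noteq> 0\<close> because \<open>P\<close> is not on
  the sides, and put \<open>u = b + c\<close>, \<open>v = c + a\<close>, \<open>w = a + b\<close>. These three sums are nonzero because
  \<open>P\<close> is not on the sides of the anticomplementary triangle
  (\<open>admissible_point_cases\<close>), and \<open>Q = (u : v : w)\<close>.

  The direction of \<open>EF\<close> is \<open>(c - b : -v : w)\<close>, from which the reflection \<open>h\<^sub>a\<close> is found to map
  \<open>(x : y : z)\<close> to a point \<open>(x' : v z / w : w y / v)\<close>. The line \<open>A h\<^sub>a(X)\<close> therefore consists of the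
  points whose last two coordinates are in the ratio \<open>v\<^sup>2/y : w\<^sup>2/z\<close> (\<open>reflected_line_iff\<close>), and,
  permuting the letters, the common point of the three lines is
  \<open>(u\<^sup>2/x : v\<^sup>2/y : w\<^sup>2/z)\<close>. So \<open>\<gamma>\<^sub>P\<close> is an isoconjugation. In the form
  \<open>(u\<^sup>2 y z : v\<^sup>2 z x : w\<^sup>2 x y)\<close> the formula holds on the whole line at infinity, where at most one
  coordinate vanishes (\<open>gen_isogonal_infinity\<close>). Since the inverse is given by
  the same formula, the image of \<open>x + y + z = 0\<close> is the conic
  \<open>u\<^sup>2 y z + v\<^sup>2 z x + w\<^sup>2 x y = 0\<close>; its points \<open>A\<close>, \<open>B\<close>, \<open>C\<close>, at which the inverse
  is not defined, are the images of the infinite points of the sides.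

  On the other side, a conic through \<open>A\<close>, \<open>B\<close>, \<open>C\<close> is \<open>l y z + m z x + n x y = 0\<close>. That it passes
  through \<open>P'\<close> and has a given point as a pole of the line at infinity amounts to three linear
  equations for \<open>(l, m, n)\<close>, so the nine-point conic is given by the vanishing of a
  determinant (\<open>bary_in_nine_point_conic_iff\<close>). Substituting the coordinates of \<open>T\<^sub>P\<^sub>'(X)\<close> into
  this equation turns it into \<open>u\<^sup>2 y z + v\<^sup>2 z x + w\<^sup>2 x y = 0\<close> (\<open>bary_in_circumconic_O_iff\<close>).
\<close>

section \<open>Points, joins and homogeneous vectors\<close>

lemma rays_hom:
  assumes "v \<noteq> 0"
  shows "rays (hom v) = span {v}"
proof -
  have "dim (span {v}) = 1"
    using assms by (simp add: dim_insert)
  then show ?thesis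
    unfolding hom_def by (simp add: Abs_ppoint_inverse)
qed

lemma ppoint_cases_hom:
  obtains v where "v \<noteq> 0" "X = hom v"
proof -
  have S: "subspace (rays X)" "dim (rays X) = 1"
    using rays[of X] by auto
  obtain B where B: "B \<subseteq> rays X" "independent B" "rays X \<subseteq> span B" "card B = dim (rays X)"
    using basis_exists by metis
  then obtain v where v: "B = {v}"
    using S card_1_singletonE by metis
  have "rays X = span {v}"
    using B S v by (metis subset_antisym span_minimal)
  then have "X = hom v"
    unfolding hom_def by (metis rays_inverse)
  moreover have "v \<noteq> 0"
    using B v by (auto simp: dependent_zero)
  ultimately show ?thesis
    using that by blast
qed

lemma hom_eq_iff:
  assumes "v \<noteq> 0" "w \<noteq> 0"
  shows "hom v = hom w \<longleftrightarrow> (\<exists>k. v = k *\<^sub>R w)"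
proof -
  have "hom v = hom w \<longleftrightarrow> span {v} = span {w}"
    using rays_hom[OF assms(1)] rays_hom[OF assms(2)] by (metis hom_def)
  also have "\<dots> \<longleftrightarrow> (\<exists>k. v = k *\<^sub>R w)"
  proof
    assume "span {v} = span {w}"
    then have "v \<in> span {w}"
      using span_base by blast
    then show "\<exists>k. v = k *\<^sub>R w"
      by (auto simp: span_singleton)
  next
    assume "\<exists>k. v = k *\<^sub>R w"
    then obtain k where k: "v = k *\<^sub>R w" ..
    then have "w = (1/k) *\<^sub>R v"
      using assms by auto
    then have "w \<in> span {v}" "v \<in> span {w}"
      using k by (metis span_base span_mul singletonI)+
    then show "span {v} = span {w}"
      by (simp add: span_minimal subset_antisym)
  qed
  finally show ?thesis .
qed

lemma hom_in_join_iff: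
  assumes "u \<noteq> 0" "v \<noteq> 0" "w \<noteq> 0"
  shows "hom w \<in> join (hom u) (hom v) \<longleftrightarrow> (\<exists>s t. w = s *\<^sub>R u + t *\<^sub>R v)"
proof -
  have "span {u} \<subseteq> span {u, v}" "span {v} \<subseteq> span {u, v}"
    by (intro span_mono; blast)+
  moreover have "{u, v} \<subseteq> span {u} \<union> span {v}"
    by (simp add: span_base)
  ultimately have "span (span {u} \<union> span {v}) = span {u, v}"
    by (intro subset_antisym span_minimal span_mono) auto
  then have "hom w \<in> join (hom u) (hom v) \<longleftrightarrow> span {w} \<subseteq> span {u, v}"
    using assms by (simp add: join_def rays_hom)
  also have "\<dots> \<longleftrightarrow> w \<in> span {u, v}"
    using span_minimal[of "{w}" "span {u, v}"] span_base[of w "{w}"] by auto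
  also have "\<dots> \<longleftrightarrow> (\<exists>s t. w = s *\<^sub>R u + t *\<^sub>R v)"
    by (auto simp: span_insert span_singleton diff_eq_eq add.commute)
  finally show ?thesis .
qed

lemma hom_in_infinity_iff:
  assumes "v \<noteq> 0"
  shows "hom v \<in> line_at_infinity \<longleftrightarrow> snd v = 0"
  using assms by (auto simp: line_at_infinity_def rays_hom span_singleton)

section \<open>Barycentric coordinates\<close>

definition bary_vec :: "real^2 \<Rightarrow> real^2 \<Rightarrow> real^2 \<Rightarrow> real \<Rightarrow> real \<Rightarrow> real \<Rightarrow> (real^2) \<times> real" where
  "bary_vec A B C x y z = (x *\<^sub>R A + y *\<^sub>R B + z *\<^sub>R C, x + y + z)"

lemma bary_eq_hom: "bary A B C x y z = hom (bary_vec A B C x y z)"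
  by (simp add: bary_def bary_vec_def)

text \<open>
  Noncollinearity says exactly that \<open>(A, 1)\<close>, \<open>(B, 1)\<close>, \<open>(C, 1)\<close> are linearly independent. Everything
  below that compares coordinates rests on this.
\<close>

lemma bary_vec_zero_iff:
  assumes "\<not> collinear {A, B, C}"
  shows "bary_vec A B C x y z = 0 \<longleftrightarrow> x = 0 \<and> y = 0 \<and> z = 0"
proof
  assume h: "bary_vec A B C x y z = 0"
  then have x: "x = - y - z" and e: "x *\<^sub>R A + y *\<^sub>R B + z *\<^sub>R C = 0"
    by (auto simp: bary_vec_def zero_prod_def)
  have e': "y *\<^sub>R (B - A) + z *\<^sub>R (C - A) = 0"
    using e unfolding x by (simp add: algebra_simps)
  have nc: "\<not> collinear {0, B - A, C - A}"
    using assms collinear_3[of B A C] by (simp add: insert_commute)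
  have "y = 0"
  proof (rule ccontr)
    assume "y \<noteq> 0"
    have "B - A = (1 / y) *\<^sub>R (y *\<^sub>R (B - A))"
      using \<open>y \<noteq> 0\<close> by simp
    also have "y *\<^sub>R (B - A) = (- z) *\<^sub>R (C - A)"
      using e' by (simp add: add_eq_0_iff2)
    finally have "B - A = (1 / y * - z) *\<^sub>R (C - A)"
      by (simp only: scaleR_scaleR)
    then have "collinear {0, C - A, B - A}"
      unfolding collinear_lemma by blast
    then show False
      using nc by (simp add: insert_commute)
  qed
  moreover have "C \<noteq> A"
    using assms by (auto simp: insert_commute)
  ultimately show "x = 0 \<and> y = 0 \<and> z = 0"
    using e' x by auto
qed (simp add: bary_vec_def zero_prod_def)

text \<open>
  An injective linear map between spaces of dimension three is bijective, so its inverse provides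
  linear coordinate functionals on homogeneous vectors.
\<close>

lemma bary_coordinates:
  assumes "\<not> collinear {A, B, C}"
  obtains f g h :: "(real^2) \<times> real \<Rightarrow> real" where
    "linear f" "linear g" "linear h"
    "\<And>x y z. f (bary_vec A B C x y z) = x"
    "\<And>x y z. g (bary_vec A B C x y z) = y"
    "\<And>x y z. h (bary_vec A B C x y z) = z"
    "\<And>v. bary_vec A B C (f v) (g v) (h v) = v"
proof -
  define F where "F = (\<lambda>(x, y, z). bary_vec A B C x y z)"
  have lin: "linear F"
    by (rule linearI) (auto simp: F_def bary_vec_def algebra_simps)
  have inj: "inj F"
    unfolding linear_injective_0[OF lin]
    using bary_vec_zero_iff[OF assms] by (auto simp: F_def zero_prod_def)
  have "dim (range F) = dim (UNIV :: ((real^2) \<times> real) set)"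
    using dim_image_eq[OF lin, of UNIV] inj by simp
  then have surj: "range F = UNIV"
    by (intro subspace_dim_equal) (auto intro: linear_subspace_image lin)
  obtain G where G: "linear G" "G \<circ> F = id"
    using linear_injective_left_inverse[OF lin inj] by blast
  have GF: "G (bary_vec A B C x y z) = (x, y, z)" for x y z
    using G(2) by (auto simp: F_def fun_eq_iff)
  have FG: "F (G v) = v" for v
    using surj G(2) by (metis comp_apply id_apply rangeE UNIV_I)
  show ?thesis
  proof
    show "linear (\<lambda>v. fst (G v))" "linear (\<lambda>v. fst (snd (G v)))" "linear (\<lambda>v. snd (snd (G v)))"
      using G(1) by (auto simp: linear_iff)
    show "bary_vec A B C (fst (G v)) (fst (snd (G v))) (snd (snd (G v))) = v" for v
      using FG[of v] by (simp add: F_def case_prod_beta)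
  qed (simp_all add: GF)
qed

lemma bary_vec_add: "bary_vec A B C x y z + bary_vec A B C x' y' z' = bary_vec A B C (x + x') (y + y') (z + z')"
  by (simp add: bary_vec_def algebra_simps)

lemma bary_vec_scaleR: "k *\<^sub>R bary_vec A B C x y z = bary_vec A B C (k * x) (k * y) (k * z)"
  by (simp add: bary_vec_def algebra_simps)

lemma bary_vec_eq_iff:
  assumes "\<not> collinear {A, B, C}"
  shows "bary_vec A B C x y z = bary_vec A B C x' y' z' \<longleftrightarrow> x = x' \<and> y = y' \<and> z = z'"
proof -
  have "bary_vec A B C x y z - bary_vec A B C x' y' z' = bary_vec A B C (x - x') (y - y') (z - z')"
    by (simp add: bary_vec_def algebra_simps)
  then show ?thesis
    using bary_vec_zero_iff[OF assms, of "x - x'" "y - y'" "z - z'"] by auto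
qed

text \<open>
  Together with \<open>noncollinear_rotate\<close> this lets every result about the vertex \<open>A\<close> be
  transferred to \<open>B\<close> and \<open>C\<close> by cyclic permutation.
\<close>

lemma bary_rotate: "bary B C A y z x = bary A B C x y z"
  by (simp add: bary_def add_ac)

lemma bary_scale: "k \<noteq> 0 \<Longrightarrow> bary A B C (k * x) (k * y) (k * z) = bary A B C x y z"
  using span_image_scale[of "{bary_vec A B C x y z}" "\<lambda>_. k"]
  by (simp add: bary_eq_hom hom_def flip: bary_vec_scaleR)

lemma ordinary_vertices:
  "ordinary A = bary A B C 1 0 0"
  "ordinary B = bary A B C 0 1 0"
  "ordinary C = bary A B C 0 0 1"
  by (simp_all add: ordinary_def bary_def)

lemma noncollinear_rotate: "\<not> collinear {A, B, C} \<Longrightarrow> \<not> collinear {B, C, A}"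
  by (simp add: insert_commute)

lemma bary_cases:
  assumes "\<not> collinear {A, B, C}"
  obtains x y z where "x \<noteq> 0 \<or> y \<noteq> 0 \<or> z \<noteq> 0" "X = bary A B C x y z"
proof -
  obtain f g h :: "(real^2) \<times> real \<Rightarrow> real"
    where "\<And>v. bary_vec A B C (f v) (g v) (h v) = v"
    using bary_coordinates[OF assms] by metis
  moreover obtain v where "v \<noteq> 0" "X = hom v"
    using ppoint_cases_hom .
  ultimately show ?thesis
    using that bary_vec_zero_iff[OF assms] bary_eq_hom by metis
qed

lemma bary_eq_iff:
  assumes "\<not> collinear {A, B, C}" "x \<noteq> 0 \<or> y \<noteq> 0 \<or> z \<noteq> 0" "x' \<noteq> 0 \<or> y' \<noteq> 0 \<or> z' \<noteq> 0"
  shows "bary A B C x y z = bary A B C x' y' z' \<longleftrightarrow> (\<exists>k. x = k * x' \<and> y = k * y' \<and> z = k * z')"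
proof -
  have "bary_vec A B C x y z \<noteq> 0" "bary_vec A B C x' y' z' \<noteq> 0"
    using assms(2-) by (auto simp: bary_vec_zero_iff[OF assms(1)])
  then show ?thesis
    by (simp add: bary_eq_hom hom_eq_iff bary_vec_eq_iff[OF assms(1)] bary_vec_scaleR)
qed

lemma bary_in_join_iff:
  assumes "\<not> collinear {A, B, C}" "x \<noteq> 0 \<or> y \<noteq> 0 \<or> z \<noteq> 0"
    "x1 \<noteq> 0 \<or> y1 \<noteq> 0 \<or> z1 \<noteq> 0" "x2 \<noteq> 0 \<or> y2 \<noteq> 0 \<or> z2 \<noteq> 0"
  shows "bary A B C x y z \<in> join (bary A B C x1 y1 z1) (bary A B C x2 y2 z2) \<longleftrightarrow>
    (\<exists>s t. x = s * x1 + t * x2 \<and> y = s * y1 + t * y2 \<and> z = s * z1 + t * z2)"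
proof -
  have "bary_vec A B C x y z \<noteq> 0" "bary_vec A B C x1 y1 z1 \<noteq> 0" "bary_vec A B C x2 y2 z2 \<noteq> 0"
    using assms(2-) by (auto simp: bary_vec_zero_iff[OF assms(1)])
  then show ?thesis
    by (simp add: bary_eq_hom hom_in_join_iff bary_vec_eq_iff[OF assms(1)] bary_vec_scaleR bary_vec_add)
qed

lemma bary_in_infinity_iff:
  assumes "\<not> collinear {A, B, C}" "x \<noteq> 0 \<or> y \<noteq> 0 \<or> z \<noteq> 0"
  shows "bary A B C x y z \<in> line_at_infinity \<longleftrightarrow> x + y + z = 0"
proof -
  have "bary_vec A B C x y z \<noteq> 0"
    using assms(2) by (auto simp: bary_vec_zero_iff[OF assms(1)])
  then show ?thesis
    by (simp add: bary_eq_hom hom_in_infinity_iff) (simp add: bary_vec_def)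
qed

text \<open>
  The sides, the cevians, the axes \<open>AQ\<close> and the lines \<open>A h\<^sub>a(X)\<close> all pass through a vertex, and on
  such a line the two other coordinates have a fixed ratio.
\<close>

lemma bary_in_line_through_vertex_iff:
  assumes "\<not> collinear {A, B, C}" "x \<noteq> 0 \<or> y \<noteq> 0 \<or> z \<noteq> 0" "y1 \<noteq> 0 \<or> z1 \<noteq> 0"
  shows "bary A B C x y z \<in> join (ordinary A) (bary A B C x1 y1 z1) \<longleftrightarrow> y * z1 = z * y1"
proof -
  have "bary A B C x y z \<in> join (ordinary A) (bary A B C x1 y1 z1) \<longleftrightarrow>
      (\<exists>s t. x = s + t * x1 \<and> y = t * y1 \<and> z = t * z1)"
    unfolding ordinary_vertices(1)[of A B C]
    using bary_in_join_iff[OF assms(1,2), of 1 0 0 x1 y1 z1] assms(3) by auto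
  also have "\<dots> \<longleftrightarrow> (\<exists>t. y = t * y1 \<and> z = t * z1)"
    by (metis diff_add_cancel)
  also have "\<dots> \<longleftrightarrow> y * z1 = z * y1"
  proof
    assume e: "y * z1 = z * y1"
    show "\<exists>t. y = t * y1 \<and> z = t * z1"
    proof (cases "y1 = 0")
      case True
      then show ?thesis
        using e assms(3) by (intro exI[of _ "z / z1"]) auto
    next
      case False
      then show ?thesis
        using e by (intro exI[of _ "y / y1"]) (auto simp: field_simps)
    qed
  qed auto
  finally show ?thesis .
qed

lemma bary_in_side_iff:
  assumes "\<not> collinear {A, B, C}" "x \<noteq> 0 \<or> y \<noteq> 0 \<or> z \<noteq> 0"
  shows "bary A B C x y z \<in> join (ordinary B) (ordinary C) \<longleftrightarrow> x = 0"
  using bary_in_line_through_vertex_iff[OF noncollinear_rotate[OF assms(1)], of y z x 1 0 0] assms(2)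
  unfolding bary_rotate[of B C A y z x] ordinary_vertices(2)[of C B A] by auto

section \<open>Cevian triangles and the isotomic map\<close>

lemma cevian_foot_bary:
  assumes "\<not> collinear {A, B, C}" "y \<noteq> 0 \<or> z \<noteq> 0"
  shows "cevian_foot A B C (bary A B C x y z) = bary A B C 0 y z"
  unfolding cevian_foot_def meet_def
proof (rule the_equality)
  show "bary A B C 0 y z \<in> join (ordinary A) (bary A B C x y z) \<and>
      bary A B C 0 y z \<in> join (ordinary B) (ordinary C)"
    using assms bary_in_line_through_vertex_iff bary_in_side_iff by simp
next
  fix Z
  assume Z: "Z \<in> join (ordinary A) (bary A B C x y z) \<and> Z \<in> join (ordinary B) (ordinary C)"
  obtain x' y' z' where nz: "x' \<noteq> 0 \<or> y' \<noteq> 0 \<or> z' \<noteq> 0" and Z': "Z = bary A B C x' y' z'"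
    using bary_cases[OF assms(1)] .
  have x': "x' = 0" and e: "y' * z = z' * y"
    using Z unfolding Z' bary_in_line_through_vertex_iff[OF assms(1) nz assms(2)]
      bary_in_side_iff[OF assms(1) nz] by auto
  have "\<exists>k. y' = k * y \<and> z' = k * z"
  proof (cases "y = 0")
    case True
    then show ?thesis
      using e assms(2) by (intro exI[of _ "z' / z"]) auto
  next
    case False
    then show ?thesis
      using e by (intro exI[of _ "y' / y"]) (auto simp: field_simps)
  qed
  then show "Z = bary A B C 0 y z"
    unfolding Z' using bary_eq_iff[OF assms(1) nz] assms(2) x' by auto
qed

lemma join_commute: "join X Y = join Y X"
  by (simp add: join_def Un_commute)

text \<open>
  The points \<open>(c : 0 : a)\<close> and \<open>(b : a : 0)\<close> are the feet \<open>E\<close> and \<open>F\<close> of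
  \<open>P = (1/a : 1/b : 1/c)\<close>. The infinite point of \<open>EF\<close> is \<open>(a + b) E - (c + a) F\<close>, the
  combination whose coordinate sum vanishes, divided by \<open>a\<close>.
\<close>

lemma direction_of_cevian_triangle_side:
  assumes "\<not> collinear {A, B, C}" "a \<noteq> 0" "c + a \<noteq> 0" "a + b \<noteq> 0"
  shows "meet (join (bary A B C c 0 a) (bary A B C b a 0)) line_at_infinity =
    bary A B C (c - b) (- (c + a)) (a + b)"
  unfolding meet_def
proof (rule the_equality)
  \<comment> \<open>The coefficients are forced by the last two coordinates.\<close>
  have "\<exists>s t. c - b = s * c + t * b \<and> - (c + a) = t * a \<and> a + b = s * a"
    using assms(2) by (intro exI[of _ "(a + b) / a"] exI[of _ "- (c + a) / a"]) (auto simp: field_simps)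
  then show "bary A B C (c - b) (- (c + a)) (a + b) \<in> join (bary A B C c 0 a) (bary A B C b a 0) \<and>
      bary A B C (c - b) (- (c + a)) (a + b) \<in> line_at_infinity"
    using assms bary_in_join_iff[OF assms(1)] bary_in_infinity_iff[OF assms(1)] by simp
next
  fix Z
  assume Z: "Z \<in> join (bary A B C c 0 a) (bary A B C b a 0) \<and> Z \<in> line_at_infinity"
  obtain x y z where nz: "x \<noteq> 0 \<or> y \<noteq> 0 \<or> z \<noteq> 0" and Z': "Z = bary A B C x y z"
    using bary_cases[OF assms(1)] .
  obtain s t where st: "x = s * c + t * b" "y = t * a" "z = s * a"
    using Z bary_in_join_iff[OF assms(1) nz, of c 0 a b a 0] assms(2) unfolding Z' by auto
  have "s * (c + a) + t * (a + b) = 0"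
    using Z bary_in_infinity_iff[OF assms(1) nz] unfolding Z' st by (simp add: algebra_simps)
  then have "t * a * (a + b) = s * a * (- (c + a))" "(s * c + t * b) * (a + b) = s * a * (c - b)"
    by algebra+
  then have "s * a = (s * a / (a + b)) * (a + b)" "t * a = (s * a / (a + b)) * (- (c + a))"
     "s * c + t * b = (s * a / (a + b)) * (c - b)"
    unfolding times_divide_eq_left using assms(4) by (simp_all add: nonzero_eq_divide_eq)
  then show "Z = bary A B C (c - b) (- (c + a)) (a + b)"
    unfolding Z' using bary_eq_iff[OF assms(1) nz] assms(3,4) st
    by metis
qed

lemma isotomic_bary:
  assumes "\<not> collinear {A, B, C}" "a \<noteq> 0" "b \<noteq> 0" "c \<noteq> 0"
  shows "isotomic A B C (bary A B C (1/a) (1/b) (1/c)) = bary A B C a b c"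
  unfolding isotomic_def
proof (rule the_equality)
  show "\<exists>x y z. x \<noteq> 0 \<and> y \<noteq> 0 \<and> z \<noteq> 0 \<and> bary A B C (1/a) (1/b) (1/c) = bary A B C x y z
      \<and> bary A B C a b c = bary A B C (1/x) (1/y) (1/z)"
    using assms by (intro exI[of _ "1/a"] exI[of _ "1/b"] exI[of _ "1/c"]) simp
next
  fix R
  assume "\<exists>x y z. x \<noteq> 0 \<and> y \<noteq> 0 \<and> z \<noteq> 0 \<and> bary A B C (1/a) (1/b) (1/c) = bary A B C x y z
      \<and> R = bary A B C (1/x) (1/y) (1/z)"
  then obtain x y z where xyz: "x \<noteq> 0" "y \<noteq> 0" "z \<noteq> 0"
    and e: "bary A B C (1/a) (1/b) (1/c) = bary A B C x y z"
    and R: "R = bary A B C (1/x) (1/y) (1/z)"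
    by blast
  obtain k where k: "1/a = k * x" "1/b = k * y" "1/c = k * z"
    using e bary_eq_iff[OF assms(1), of "1/a" "1/b" "1/c" x y z] assms xyz by auto
  then have "k \<noteq> 0"
    using assms(2) by auto
  have "1/x = k * a" "1/y = k * b" "1/z = k * c"
    using k assms xyz by (simp_all add: field_simps)
  then show "R = bary A B C a b c"
    unfolding R using bary_scale[OF \<open>k \<noteq> 0\<close>] by simp
qed

section \<open>Affine maps in barycentric coordinates\<close>

lemma ordinary_affine_combination:
  "x + y + z = 1 \<Longrightarrow> ordinary (x *\<^sub>R A + y *\<^sub>R B + z *\<^sub>R C) = bary A B C x y z"
  by (simp add: ordinary_def bary_def)

lemma ordinary_inject: "ordinary X = ordinary Y \<longleftrightarrow> X = Y"
  by (auto simp: ordinary_def hom_eq_iff zero_prod_def)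

lemma affine_combination_cases:
  fixes A B C X :: "real^2"
  assumes "\<not> collinear {A, B, C}"
  obtains x y z where "x + y + z = 1" "X = x *\<^sub>R A + y *\<^sub>R B + z *\<^sub>R C"
proof -
  obtain f g h :: "(real^2) \<times> real \<Rightarrow> real"
    where "\<And>v. bary_vec A B C (f v) (g v) (h v) = v"
    using bary_coordinates[OF assms] by metis
  then have "bary_vec A B C (f (X, 1)) (g (X, 1)) (h (X, 1)) = (X, 1)"
    by blast
  then have "f (X, 1) + g (X, 1) + h (X, 1) = 1"
    "X = f (X, 1) *\<^sub>R A + g (X, 1) *\<^sub>R B + h (X, 1) *\<^sub>R C"
    by (simp_all add: bary_vec_def)
  then show ?thesis
    by (rule that)
qed

lemma affine_map_combination:
  assumes "affine_map f" "x + y + z = 1"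
  shows "f (x *\<^sub>R A + y *\<^sub>R B + z *\<^sub>R C) = x *\<^sub>R f A + y *\<^sub>R f B + z *\<^sub>R f C"
proof -
  obtain g b where g: "linear g" and f: "f = (\<lambda>X. g X + b)"
    using assms(1) unfolding affine_map_def by blast
  have "x *\<^sub>R b + y *\<^sub>R b + z *\<^sub>R b = b"
    using assms(2) by (simp flip: scaleR_left_distrib)
  then show ?thesis
    unfolding f by (simp add: linear_add[OF g] linear_cmul[OF g] scaleR_right_distrib)
      (metis (no_types, opaque_lifting) add.assoc add.commute)
qed

lemma affine_map_eqI:
  assumes "\<not> collinear {A, B, C}" "affine_map f"
    "\<And>x y z. x + y + z = 1 \<Longrightarrow>
      g (x *\<^sub>R A + y *\<^sub>R B + z *\<^sub>R C) = x *\<^sub>R f A + y *\<^sub>R f B + z *\<^sub>R f C"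
  shows "g = f"
proof
  fix X
  show "g X = f X"
    using affine_combination_cases[OF assms(1), of X] affine_map_combination[OF assms(2)] assms(3)
    by metis
qed

lemma affine_map_exists:
  assumes "\<not> collinear {A, B, C}"
  obtains f where "affine_map f" "f A = A'" "f B = B'" "f C = C'"
proof -
  obtain f g h :: "(real^2) \<times> real \<Rightarrow> real" where
    lin: "linear f" "linear g" "linear h" and
    f: "\<And>x y z. f (bary_vec A B C x y z) = x" and
    g: "\<And>x y z. g (bary_vec A B C x y z) = y" and
    h: "\<And>x y z. h (bary_vec A B C x y z) = z"
    using bary_coordinates[OF assms] by metis
  define L where "L = (\<lambda>v. f v *\<^sub>R A' + g v *\<^sub>R B' + h v *\<^sub>R C')"
  have L: "linear L"
    unfolding L_def using lin by (auto simp: linear_iff algebra_simps)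
  have "linear (\<lambda>X. L (X, 0))"
    by (rule linearI) (simp_all flip: linear_add[OF L] linear_cmul[OF L])
  moreover have "(\<lambda>X. L (X, 1)) = (\<lambda>X. L (X, 0) + L (0, 1))"
    by (simp flip: linear_add[OF L])
  ultimately have "affine_map (\<lambda>X. L (X, 1))"
    unfolding affine_map_def by (intro exI[of _ "\<lambda>X. L (X, 0)"] exI[of _ "L (0, 1)"]) blast
  moreover have "(A, 1) = bary_vec A B C 1 0 0" "(B, 1) = bary_vec A B C 0 1 0" "(C, 1) = bary_vec A B C 0 0 1"
    by (simp_all add: bary_vec_def)
  ultimately show ?thesis
    by (intro that[of "\<lambda>X. L (X, 1)"]) (simp_all add: L_def f g h)
qed

text \<open>
  The extension is the projective map of a linear map of homogeneous vectors, which carries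
  \<open>span {v}\<close> to the span of the image of \<open>v\<close>.
\<close>

lemma affine_ext_hom:
  assumes "linear g" "f = (\<lambda>X. g X + b)" "v \<noteq> 0"
  shows "affine_ext f (hom v) = hom (g (fst v) + snd v *\<^sub>R b, snd v)"
proof -
  have f0: "f 0 = b"
    using linear_0[OF assms(1)] by (simp add: assms(2))
  define L where "L = (\<lambda>v :: (real^2) \<times> real. (g (fst v) + snd v *\<^sub>R b, snd v))"
  have "linear L"
    by (rule linearI)
      (simp_all add: L_def linear_add[OF assms(1)] linear_cmul[OF assms(1)] algebra_simps)
  then have "L ` span {v} = span {L v}"
    by (metis linear_span_image image_empty image_insert)
  moreover have "(\<lambda>(v, w). (f v - f 0 + w *\<^sub>R f 0, w)) = L"
    unfolding f0 by (auto simp: L_def assms(2))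
  ultimately show ?thesis
    unfolding affine_ext_def rays_hom[OF assms(3)] by (simp add: hom_def L_def)
qed

text \<open>
  An affine map keeps barycentric coordinates when the triangle is mapped along, at infinite points as
  well as at ordinary ones. So an extended affine map can be computed everywhere from its values at the
  three vertices.
\<close>

lemma affine_ext_bary:
  assumes "\<not> collinear {A, B, C}" "affine_map f" "x \<noteq> 0 \<or> y \<noteq> 0 \<or> z \<noteq> 0"
  shows "affine_ext f (bary A B C x y z) = bary (f A) (f B) (f C) x y z"
proof -
  obtain g b where g: "linear g" and f: "f = (\<lambda>X. g X + b)"
    using assms(2) unfolding affine_map_def by blast
  have "bary_vec A B C x y z \<noteq> 0"
    using assms(3) by (auto simp: bary_vec_zero_iff[OF assms(1)])
  from affine_ext_hom[OF g f this] show ?thesis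
    unfolding bary_eq_hom
    by (simp add: bary_vec_def f linear_add[OF g] linear_cmul[OF g] algebra_simps)
qed

lemma affine_map_complement: "affine_map (complement_map A B C)"
  unfolding affine_map_def complement_map_def Let_def
proof (intro exI conjI)
  show "linear (\<lambda>X :: real^2. (-1/2) *\<^sub>R X)"
    by (rule linear_scaleR)
  show "(\<lambda>X. (1/3) *\<^sub>R (A + B + C) + (-1/2) *\<^sub>R (X - (1/3) *\<^sub>R (A + B + C))) =
      (\<lambda>X. (-1/2) *\<^sub>R X + (1/2) *\<^sub>R (A + B + C))"
    by (rule ext) (simp add: vec_eq_iff algebra_simps)
qed

lemma complement_vertex: "complement_map A B C A = (1/2) *\<^sub>R B + (1/2) *\<^sub>R C"
  by (simp add: complement_map_def vec_eq_iff algebra_simps)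

lemma complement_map_rotate: "complement_map A B C = complement_map B C A"
  by (simp add: complement_map_def fun_eq_iff add_ac)

lemma complement_bary:
  assumes "\<not> collinear {A, B, C}" "x \<noteq> 0 \<or> y \<noteq> 0 \<or> z \<noteq> 0"
  shows "affine_ext (complement_map A B C) (bary A B C x y z) = bary A B C (y + z) (z + x) (x + y)"
proof -
  have "affine_ext (complement_map A B C) (bary A B C x y z) =
      bary ((1/2) *\<^sub>R B + (1/2) *\<^sub>R C) ((1/2) *\<^sub>R C + (1/2) *\<^sub>R A) ((1/2) *\<^sub>R A + (1/2) *\<^sub>R B) x y z"
    using affine_ext_bary[OF assms(1) affine_map_complement[of A B C] assms(2)]
      complement_vertex[of A B C] complement_vertex[of B C A] complement_vertex[of C A B]
      complement_map_rotate[of A B C] complement_map_rotate[of C A B]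
    by simp
  also have "\<dots> = bary A B C (1/2 * (y + z)) (1/2 * (z + x)) (1/2 * (x + y))"
    unfolding bary_def
    by (rule arg_cong[of _ _ hom]) (simp add: vec_eq_iff algebra_simps add_divide_distrib)
  finally show ?thesis
    by (simp only: bary_scale)
qed

text \<open>
  With \<open>G\<close> the centroid, \<open>K\<^sup>-\<^sup>1(A) = 3 G - 2 A\<close>.
\<close>

lemma anticomplementary_vertex:
  "inv (complement_map A B C) A = B + C - A"
proof (rule inv_f_eq)
  show "inj (complement_map A B C)"
    by (rule injI) (simp add: complement_map_def Let_def)
  show "complement_map A B C (B + C - A) = A"
    by (simp add: complement_map_def vec_eq_iff algebra_simps)
qed

text \<open>
  The side through \<open>K\<^sup>-\<^sup>1(B) = (1 : -1 : 1)\<close> and \<open>K\<^sup>-\<^sup>1(C) = (1 : 1 : -1)\<close> is the parallel to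
  \<open>BC\<close> through \<open>A\<close>, with equation \<open>y + z = 0\<close>.
\<close>

lemma on_anticomplementary_side:
  assumes "\<not> collinear {A, B, C}" "x \<noteq> 0 \<or> y \<noteq> 0 \<or> z \<noteq> 0" "y + z = 0"
  shows "bary A B C x y z \<in> on_sides_anticomplementary A B C"
proof -
  have B: "ordinary (inv (complement_map A B C) B) = bary A B C 1 (-1) 1"
    using anticomplementary_vertex[of B C A] complement_map_rotate[of A B C]
    by (simp add: ordinary_def bary_def) (simp add: algebra_simps)
  have C: "ordinary (inv (complement_map A B C) C) = bary A B C 1 1 (-1)"
    using anticomplementary_vertex[of C A B] complement_map_rotate[of C A B]
    by (simp add: ordinary_def bary_def)
  have "\<exists>s t. x = s * 1 + t * 1 \<and> y = s * (-1) + t * 1 \<and> z = s * 1 + t * (-1)"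
    using assms(3) by (intro exI[of _ "(x - y) / 2"] exI[of _ "(x + y) / 2"]) (auto simp: field_simps)
  then show ?thesis
    unfolding on_sides_anticomplementary_def on_sides_def Let_def B C
    using bary_in_join_iff[OF assms(1,2), of 1 "-1" 1 1 1 "-1"] by simp
qed

lemma on_sides_anticomplementary_rotate:
  "on_sides_anticomplementary A B C = on_sides_anticomplementary B C A"
  unfolding on_sides_anticomplementary_def on_sides_def complement_map_rotate[of A B C] Let_def
  by blast

section \<open>Affine reflections about a line through a vertex\<close>

text \<open>
  The image of \<open>X\<close> is \<open>X + t d\<close>, where \<open>t\<close> is determined by the condition that \<open>X + (t/2) d\<close> lies on
  the axis \<open>y q3 = z q2\<close>. This is a linear equation for \<open>t\<close>; it has exactly one solution when \<open>d\<close> is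
  not on the axis, that is, when \<open>d2 q3 - d3 q2\<close> is nonzero.
\<close>

lemma affine_reflection_combination:
  fixes A B C :: "real^2"
  assumes nc: "\<not> collinear {A, B, C}" and d: "d1 + d2 + d3 = 0"
    and k: "d2 * q3 - d3 * q2 \<noteq> 0" and xyz: "x + y + z = 1"
  defines "t \<equiv> 2 * (z * q2 - y * q3) / (d2 * q3 - d3 * q2)"
  shows "affine_reflection (join (ordinary A) (bary A B C q1 q2 q3)) (bary A B C d1 d2 d3)
      (x *\<^sub>R A + y *\<^sub>R B + z *\<^sub>R C) = (x + t * d1) *\<^sub>R A + (y + t * d2) *\<^sub>R B + (z + t * d3) *\<^sub>R C"
proof -
  have q0: "q2 \<noteq> 0 \<or> q3 \<noteq> 0" and d0: "d1 \<noteq> 0 \<or> d2 \<noteq> 0 \<or> d3 \<noteq> 0" and x0: "x \<noteq> 0 \<or> y \<noteq> 0 \<or> z \<noteq> 0"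
    using k xyz by auto
  have direction: "ordinary (x' *\<^sub>R A + y' *\<^sub>R B + z' *\<^sub>R C)
        \<in> join (ordinary (x *\<^sub>R A + y *\<^sub>R B + z *\<^sub>R C)) (bary A B C d1 d2 d3) \<longleftrightarrow>
      (\<exists>r. x' = x + r * d1 \<and> y' = y + r * d2 \<and> z' = z + r * d3)"
    if s: "x' + y' + z' = 1" for x' y' z'
  proof -
    have n: "x' \<noteq> 0 \<or> y' \<noteq> 0 \<or> z' \<noteq> 0"
      using s by auto
    \<comment> \<open>Normalized coordinates have sum 1 and those of \<open>d\<close> have sum 0, so \<open>X\<close> enters with weight 1.\<close>
    have "p = 1" if "x' = p * x + r * d1" "y' = p * y + r * d2" "z' = p * z + r * d3" for p r
    proof -
      have "x' + y' + z' = p * (x + y + z) + r * (d1 + d2 + d3)"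
        unfolding that by (simp add: algebra_simps)
      then show ?thesis
        using s xyz d by simp
    qed
    then have "(\<exists>p r. x' = p * x + r * d1 \<and> y' = p * y + r * d2 \<and> z' = p * z + r * d3) \<longleftrightarrow>
      (\<exists>r. x' = x + r * d1 \<and> y' = y + r * d2 \<and> z' = z + r * d3)"
      by (metis mult_1)
    then show ?thesis
      unfolding ordinary_affine_combination[OF s] ordinary_affine_combination[OF xyz]
        bary_in_join_iff[OF nc n x0 d0] .
  qed
  have axis: "ordinary (midpoint (x *\<^sub>R A + y *\<^sub>R B + z *\<^sub>R C) (x' *\<^sub>R A + y' *\<^sub>R B + z' *\<^sub>R C))
        \<in> join (ordinary A) (bary A B C q1 q2 q3) \<longleftrightarrow> (y + y') * q3 = (z + z') * q2"
    if s: "x' + y' + z' = 1" for x' y' z'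
  proof -
    have m: "midpoint (x *\<^sub>R A + y *\<^sub>R B + z *\<^sub>R C) (x' *\<^sub>R A + y' *\<^sub>R B + z' *\<^sub>R C) =
        ((x + x') / 2) *\<^sub>R A + ((y + y') / 2) *\<^sub>R B + ((z + z') / 2) *\<^sub>R C"
      by (simp add: midpoint_def vec_eq_iff field_simps)
    have s': "(x + x') / 2 + (y + y') / 2 + (z + z') / 2 = 1"
      using s xyz by (simp add: field_simps)
    then have n: "(x + x') / 2 \<noteq> 0 \<or> (y + y') / 2 \<noteq> 0 \<or> (z + z') / 2 \<noteq> 0"
      by auto
    show ?thesis
      unfolding m ordinary_affine_combination[OF s'] bary_in_line_through_vertex_iff[OF nc n q0]
      by simp
  qed
  have solve: "(y + (y + r * d2)) * q3 = (z + (z + r * d3)) * q2 \<longleftrightarrow> r = t" for r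
  proof -
    have "(y + (y + r * d2)) * q3 = (z + (z + r * d3)) * q2 \<longleftrightarrow>
        r * (d2 * q3 - d3 * q2) = 2 * (z * q2 - y * q3)"
      by (auto simp: algebra_simps)
    also have "\<dots> \<longleftrightarrow> r = t"
      unfolding t_def using k by (simp add: nonzero_eq_divide_eq)
    finally show ?thesis .
  qed
  have s: "(x + r * d1) + (y + r * d2) + (z + r * d3) = 1" for r
  proof -
    have "(x + r * d1) + (y + r * d2) + (z + r * d3) = x + y + z + r * (d1 + d2 + d3)"
      by (simp add: algebra_simps)
    then show ?thesis
      using xyz d by simp
  qed
  show ?thesis
    unfolding affine_reflection_def
  proof (rule the_equality)
    show "ordinary ((x + t * d1) *\<^sub>R A + (y + t * d2) *\<^sub>R B + (z + t * d3) *\<^sub>R C)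
        \<in> join (ordinary (x *\<^sub>R A + y *\<^sub>R B + z *\<^sub>R C)) (bary A B C d1 d2 d3) \<and>
      ordinary (midpoint (x *\<^sub>R A + y *\<^sub>R B + z *\<^sub>R C)
          ((x + t * d1) *\<^sub>R A + (y + t * d2) *\<^sub>R B + (z + t * d3) *\<^sub>R C))
        \<in> join (ordinary A) (bary A B C q1 q2 q3)"
      unfolding direction[OF s] axis[OF s] solve by blast
  next
    fix X'
    assume X': "ordinary X' \<in> join (ordinary (x *\<^sub>R A + y *\<^sub>R B + z *\<^sub>R C)) (bary A B C d1 d2 d3) \<and>
      ordinary (midpoint (x *\<^sub>R A + y *\<^sub>R B + z *\<^sub>R C) X') \<in> join (ordinary A) (bary A B C q1 q2 q3)"
    obtain x' y' z' where s': "x' + y' + z' = 1" and e: "X' = x' *\<^sub>R A + y' *\<^sub>R B + z' *\<^sub>R C"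
      using affine_combination_cases[OF nc] .
    obtain r where r: "x' = x + r * d1" "y' = y + r * d2" "z' = z + r * d3"
      using X' direction[OF s'] unfolding e by blast
    have "r = t"
      using X' axis[OF s'] solve[of r] unfolding e r by blast
    then show "X' = (x + t * d1) *\<^sub>R A + (y + t * d2) *\<^sub>R B + (z + t * d3) *\<^sub>R C"
      unfolding e r by simp
  qed
qed

text \<open>
  The reflection is known on ordinary points, where it is affine because \<open>t\<close> depends linearly on the
  coordinates. Its values at the vertices then determine it on the whole extended plane.
\<close>

lemma affine_ext_reflection_bary:
  fixes A B C :: "real^2"
  assumes nc: "\<not> collinear {A, B, C}" and d: "d1 + d2 + d3 = 0"
    and k: "d2 * q3 - d3 * q2 \<noteq> 0" and nz: "x \<noteq> 0 \<or> y \<noteq> 0 \<or> z \<noteq> 0"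
  defines "t \<equiv> 2 * (z * q2 - y * q3) / (d2 * q3 - d3 * q2)"
  shows "affine_ext (affine_reflection (join (ordinary A) (bary A B C q1 q2 q3)) (bary A B C d1 d2 d3))
      (bary A B C x y z) = bary A B C (x + t * d1) (y + t * d2) (z + t * d3)"
proof -
  define h where "h = affine_reflection (join (ordinary A) (bary A B C q1 q2 q3)) (bary A B C d1 d2 d3)"
  \<comment> \<open>The parameter \<open>t\<close> as a function of the coordinates; it does not involve the first one.\<close>
  define T where "T = (\<lambda>y z. 2 * (z * q2 - y * q3) / (d2 * q3 - d3 * q2))"
  have h: "h (x *\<^sub>R A + y *\<^sub>R B + z *\<^sub>R C) =
      (x + T y z * d1) *\<^sub>R A + (y + T y z * d2) *\<^sub>R B + (z + T y z * d3) *\<^sub>R C"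
    if "x + y + z = 1" for x y z
    unfolding h_def T_def using affine_reflection_combination[OF nc d k that] .
  have T: "T y z = y * T 1 0 + z * T 0 1" for y z
    by (simp add: T_def diff_divide_distrib algebra_simps)
  have "T 0 0 = 0"
    by (simp add: T_def)
  have hABC: "h A = A" "h B = (T 1 0 * d1) *\<^sub>R A + (1 + T 1 0 * d2) *\<^sub>R B + (T 1 0 * d3) *\<^sub>R C"
    "h C = (T 0 1 * d1) *\<^sub>R A + (T 0 1 * d2) *\<^sub>R B + (1 + T 0 1 * d3) *\<^sub>R C"
    using h[of 1 0 0] h[of 0 1 0] h[of 0 0 1] \<open>T 0 0 = 0\<close> by simp_all
  obtain f where f: "affine_map f" "f A = h A" "f B = h B" "f C = h C"
    using affine_map_exists[OF nc] .
  have "h = f"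
  proof (rule affine_map_eqI[OF nc f(1)])
    fix x y z :: real
    assume s: "x + y + z = 1"
    show "h (x *\<^sub>R A + y *\<^sub>R B + z *\<^sub>R C) = x *\<^sub>R f A + y *\<^sub>R f B + z *\<^sub>R f C"
      unfolding h[OF s] f hABC T[of y z] by (simp add: algebra_simps)
  qed
  then have "affine_ext h (bary A B C x y z) = bary (h A) (h B) (h C) x y z"
    using affine_ext_bary[OF nc f(1) nz] by simp
  also have "\<dots> = bary A B C (x + T y z * d1) (y + T y z * d2) (z + T y z * d3)"
  proof -
    have "T y z * d1 + T y z * d2 + T y z * d3 = 0"
      using d by (metis mult_zero_right ring_class.ring_distribs(1))
    then have "x + y + z = x + T y z * d1 + (y + T y z * d2) + (z + T y z * d3)"
      by linarith
    moreover have "x *\<^sub>R h A + y *\<^sub>R h B + z *\<^sub>R h C =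
      (x + T y z * d1) *\<^sub>R A + (y + T y z * d2) *\<^sub>R B + (z + T y z * d3) *\<^sub>R C"
      unfolding hABC T[of y z] by (simp add: algebra_simps)
    ultimately show ?thesis
      unfolding bary_def by (simp only:)
  qed
  finally show ?thesis
    unfolding h_def T_def t_def .
qed

section \<open>The generalized isogonal map on the line at infinity\<close>

text \<open>
  With \<open>v = c + a\<close> and \<open>w = a + b\<close>, the axis \<open>AQ\<close> is
  \<open>w y = v z\<close> and the direction is \<open>(c - b : -v : w)\<close>, so that the reflection exchanges the last two
  coordinates up to scaling, \<open>(y, z) \<mapsto> (v z / w, w y / v)\<close>.
\<close>

lemma reflected_line_iff:
  fixes A B C :: "real^2" and a b c :: real
  assumes nc: "\<not> collinear {A, B, C}" and nz: "a \<noteq> 0" "c + a \<noteq> 0" "a + b \<noteq> 0"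
    and X: "y \<noteq> 0 \<or> z \<noteq> 0" and Y: "x' \<noteq> 0 \<or> y' \<noteq> 0 \<or> z' \<noteq> 0"
  shows "bary A B C x' y' z' \<in> join (ordinary A)
      (affine_ext (affine_reflection (join (ordinary A) (bary A B C (b + c) (c + a) (a + b)))
          (meet (join (bary A B C c 0 a) (bary A B C b a 0)) line_at_infinity))
        (bary A B C x y z)) \<longleftrightarrow>
    y' * ((a + b)\<^sup>2 * y) = z' * ((c + a)\<^sup>2 * z)"
proof -
  define v w where "v = c + a" and "w = a + b"
  have vw: "v \<noteq> 0" "w \<noteq> 0"
    using nz by (auto simp: v_def w_def)
  define t where "t = 2 * (z * v - y * w) / (- v * w - w * v)"
  have k: "- v * w - w * v \<noteq> 0"
    using vw by simp
  have d: "(c - b) + - v + w = 0"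
    by (simp add: v_def w_def)
  have nz': "x \<noteq> 0 \<or> y \<noteq> 0 \<or> z \<noteq> 0"
    using X by blast
  have t: "t = (y * w - z * v) / (v * w)"
    using vw by (simp add: t_def divide_simps)
  have co: "y + t * - v = z * v / w" "z + t * w = y * w / v"
    unfolding t using vw by (simp_all add: divide_simps)
  have "affine_ext (affine_reflection (join (ordinary A) (bary A B C (b + c) (c + a) (a + b)))
          (meet (join (bary A B C c 0 a) (bary A B C b a 0)) line_at_infinity)) (bary A B C x y z) =
      bary A B C (x + t * (c - b)) (z * v / w) (y * w / v)"
    unfolding direction_of_cevian_triangle_side[OF nc nz] co[symmetric] t_def unfolding v_def w_def
    by (rule affine_ext_reflection_bary[OF nc d k nz', unfolded v_def w_def])
  moreover have "bary A B C x' y' z' \<in> join (ordinary A)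
      (bary A B C (x + t * (c - b)) (z * v / w) (y * w / v)) \<longleftrightarrow> y' * (y * w / v) = z' * (z * v / w)"
    using X vw by (intro bary_in_line_through_vertex_iff[OF nc Y]) auto
  moreover have "y' * (y * w / v) = z' * (z * v / w) \<longleftrightarrow> y' * (w\<^sup>2 * y) = z' * (v\<^sup>2 * z)"
    using vw by (simp add: divide_simps power2_eq_square) (auto simp: algebra_simps)
  ultimately show ?thesis
    unfolding v_def w_def by (simp only:)
qed

text \<open>
  With \<open>u = b + c\<close>, \<open>v = c + a\<close>, \<open>w = a + b\<close>, the three lines are
  \<open>y' w\<^sup>2 y = z' v\<^sup>2 z\<close>, \<open>z' u\<^sup>2 z = x' w\<^sup>2 x\<close> and \<open>x' v\<^sup>2 x = y' u\<^sup>2 y\<close>. They have exactly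
  one common point as soon as at most one of \<open>x\<close>, \<open>y\<close>, \<open>z\<close> is zero, which holds at infinity
  because the vertices are ordinary.
\<close>

lemma gen_isogonal_infinity:
  fixes A B C :: "real^2" and a b c :: real
  assumes nc: "\<not> collinear {A, B, C}"
    and abc: "a \<noteq> 0" "b \<noteq> 0" "c \<noteq> 0" and uvw: "b + c \<noteq> 0" "c + a \<noteq> 0" "a + b \<noteq> 0"
    and X: "x + y + z = 0" "x \<noteq> 0 \<or> y \<noteq> 0 \<or> z \<noteq> 0"
  shows "gen_isogonal A B C (bary A B C (1/a) (1/b) (1/c)) (bary A B C x y z) =
    bary A B C ((b + c)\<^sup>2 * (y * z)) ((c + a)\<^sup>2 * (z * x)) ((a + b)\<^sup>2 * (x * y))"
proof -
  have nc2: "\<not> collinear {B, C, A}" and nc3: "\<not> collinear {C, A, B}"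
    using nc noncollinear_rotate by blast+
  have X2: "y \<noteq> 0 \<or> z \<noteq> 0" "z \<noteq> 0 \<or> x \<noteq> 0" "x \<noteq> 0 \<or> y \<noteq> 0"
    using X by auto
  let ?P = "bary A B C (1/a) (1/b) (1/c)"
  have Q: "affine_ext (complement_map A B C) (isotomic A B C ?P) = bary A B C (b + c) (c + a) (a + b)"
    using isotomic_bary[OF nc abc] complement_bary[OF nc] abc(1) by simp
  have "bary A B C 0 (1/b) (1/c) = bary A B C 0 c b"
    using bary_scale[of "1 / (b * c)" A B C 0 c b] abc by simp
  then have D: "cevian_foot A B C ?P = bary A B C 0 c b"
    using cevian_foot_bary[OF nc, of "1/b" "1/c" "1/a"] abc by simp
  have "bary A B C (1/a) 0 (1/c) = bary A B C c 0 a"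
    using bary_scale[of "1 / (a * c)" A B C c 0 a] abc by simp
  then have E: "cevian_foot B C A ?P = bary A B C c 0 a"
    using cevian_foot_bary[OF nc2, of "1/c" "1/a" "1/b"] abc
    by (simp add: bary_rotate[of B C A])
  have "bary A B C (1/a) (1/b) 0 = bary A B C b a 0"
    using bary_scale[of "1 / (a * b)" A B C b a 0] abc by simp
  then have F: "cevian_foot C A B ?P = bary A B C b a 0"
    using cevian_foot_bary[OF nc3, of "1/a" "1/b" "1/c"] abc
    by (simp add: bary_rotate[of B C A] bary_rotate[of C A B])
  define h where "h = (\<lambda>V Y Z. affine_ext
    (affine_reflection (join (ordinary V) (bary A B C (b + c) (c + a) (a + b)))
      (meet (join Y Z) line_at_infinity)))"
  define ha hb hc where "ha = h A (bary A B C c 0 a) (bary A B C b a 0) (bary A B C x y z)"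
    and "hb = h B (bary A B C 0 c b) (bary A B C b a 0) (bary A B C x y z)"
    and "hc = h C (bary A B C 0 c b) (bary A B C c 0 a) (bary A B C x y z)"
  have gamma: "gen_isogonal A B C ?P (bary A B C x y z) =
      (THE Y. Y \<in> join (ordinary A) ha \<and> Y \<in> join (ordinary B) hb \<and> Y \<in> join (ordinary C) hc)"
    unfolding gen_isogonal_def Let_def Q D E F h_def ha_def hb_def hc_def by (rule refl)
  have A: "bary A B C x' y' z' \<in> join (ordinary A) ha \<longleftrightarrow>
      y' * ((a + b)\<^sup>2 * y) = z' * ((c + a)\<^sup>2 * z)"
    if "x' \<noteq> 0 \<or> y' \<noteq> 0 \<or> z' \<noteq> 0" for x' y' z'
    unfolding ha_def h_def by (rule reflected_line_iff[OF nc abc(1) uvw(2,3) X2(1) that])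
  have B: "bary A B C x' y' z' \<in> join (ordinary B) hb \<longleftrightarrow>
      z' * ((b + c)\<^sup>2 * z) = x' * ((a + b)\<^sup>2 * x)"
    if n: "x' \<noteq> 0 \<or> y' \<noteq> 0 \<or> z' \<noteq> 0" for x' y' z'
  proof -
    have "y' \<noteq> 0 \<or> z' \<noteq> 0 \<or> x' \<noteq> 0"
      using n by blast
    from reflected_line_iff[OF nc2 abc(2) uvw(3,1) X2(2) this]
    show ?thesis
      unfolding hb_def h_def join_commute[of "bary A B C 0 c b"]
      by (simp only: bary_rotate[of B C A])
  qed
  have C: "bary A B C x' y' z' \<in> join (ordinary C) hc \<longleftrightarrow>
      x' * ((c + a)\<^sup>2 * x) = y' * ((b + c)\<^sup>2 * y)"
    if n: "x' \<noteq> 0 \<or> y' \<noteq> 0 \<or> z' \<noteq> 0" for x' y' z'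
  proof -
    have "z' \<noteq> 0 \<or> x' \<noteq> 0 \<or> y' \<noteq> 0"
      using n by blast
    from reflected_line_iff[OF nc3 abc(3) uvw(1,2) X2(3) this]
    show ?thesis
      unfolding hc_def h_def
      by (simp only: bary_rotate[of B C A] bary_rotate[of C A B])
  qed
  have image_nz: "(b + c)\<^sup>2 * (y * z) \<noteq> 0 \<or> (c + a)\<^sup>2 * (z * x) \<noteq> 0 \<or> (a + b)\<^sup>2 * (x * y) \<noteq> 0"
    using X2 uvw by auto
  show ?thesis
    unfolding gamma
  proof (rule the_equality)
    show "bary A B C ((b + c)\<^sup>2 * (y * z)) ((c + a)\<^sup>2 * (z * x)) ((a + b)\<^sup>2 * (x * y)) \<in> join (ordinary A) ha \<and>
      bary A B C ((b + c)\<^sup>2 * (y * z)) ((c + a)\<^sup>2 * (z * x)) ((a + b)\<^sup>2 * (x * y)) \<in> join (ordinary B) hb \<and>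
      bary A B C ((b + c)\<^sup>2 * (y * z)) ((c + a)\<^sup>2 * (z * x)) ((a + b)\<^sup>2 * (x * y)) \<in> join (ordinary C) hc"
      unfolding A[OF image_nz] B[OF image_nz] C[OF image_nz] by (simp add: mult_ac)
  next
    fix Y
    assume Y: "Y \<in> join (ordinary A) ha \<and> Y \<in> join (ordinary B) hb \<and> Y \<in> join (ordinary C) hc"
    obtain x' y' z' where n: "x' \<noteq> 0 \<or> y' \<noteq> 0 \<or> z' \<noteq> 0" and Y': "Y = bary A B C x' y' z'"
      using bary_cases[OF nc] .
    define u v w where "u = (b + c)\<^sup>2" and "v = (c + a)\<^sup>2" and "w = (a + b)\<^sup>2"
    have nzs: "u \<noteq> 0" "v \<noteq> 0" "w \<noteq> 0"
      using uvw by (simp_all add: u_def v_def w_def)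
    have e: "y' * (w * y) = z' * (v * z)" "z' * (u * z) = x' * (w * x)" "x' * (v * x) = y' * (u * y)"
      using Y unfolding Y' A[OF n] B[OF n] C[OF n] u_def v_def w_def by auto
    have "\<exists>k. x' = k * (u * (y * z)) \<and> y' = k * (v * (z * x)) \<and> z' = k * (w * (x * y))"
    proof -
      \<comment> \<open>The factor is read off from any nonzero coordinate of the image.\<close>
      consider "y * z \<noteq> 0" | "z * x \<noteq> 0" | "x * y \<noteq> 0"
        using X2 by auto
      then show ?thesis
      proof cases
        case 1
        then show ?thesis
          using e nzs by (intro exI[of _ "x' / (u * (y * z))"]) (auto simp: field_simps)
      next
        case 2
        then show ?thesis
          using e nzs by (intro exI[of _ "y' / (v * (z * x))"]) (auto simp: field_simps)
      next
        case 3
        then show ?thesis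
          using e nzs by (intro exI[of _ "z' / (w * (x * y))"]) (auto simp: field_simps)
      qed
    qed
    then show "Y = bary A B C ((b + c)\<^sup>2 * (y * z)) ((c + a)\<^sup>2 * (z * x)) ((a + b)\<^sup>2 * (x * y))"
      unfolding Y' bary_eq_iff[OF nc n image_nz] by (simp only: u_def v_def w_def)
  qed
qed

section \<open>The nine-point conic\<close>

lemma homogeneous_system_3_iff:
  fixes a1 b1 c1 a2 b2 c2 a3 b3 c3 :: real
  shows "(\<exists>l m n. (l \<noteq> 0 \<or> m \<noteq> 0 \<or> n \<noteq> 0) \<and> a1 * l + b1 * m + c1 * n = 0 \<and>
      a2 * l + b2 * m + c2 * n = 0 \<and> a3 * l + b3 * m + c3 * n = 0) \<longleftrightarrow>
    a1 * (b2 * c3 - c2 * b3) + b1 * (c2 * a3 - a2 * c3) + c1 * (a2 * b3 - b2 * a3) = 0"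
proof -
  define M :: "real^3^3" where "M = vector [vector [a1, b1, c1], vector [a2, b2, c2], vector [a3, b3, c3]]"
  have "det M = a1 * (b2 * c3 - c2 * b3) + b1 * (c2 * a3 - a2 * c3) + c1 * (a2 * b3 - b2 * a3)"
    by (simp add: M_def det_3 algebra_simps)
  moreover have "det M = 0 \<longleftrightarrow> (\<exists>x. M *v x = 0 \<and> x \<noteq> 0)"
    using invertible_det_nz[of M] invertible_left_inverse[of M] matrix_left_invertible_ker[of M] by blast
  moreover have "(\<exists>x. M *v x = 0 \<and> x \<noteq> 0) \<longleftrightarrow>
    (\<exists>l m n. (l \<noteq> 0 \<or> m \<noteq> 0 \<or> n \<noteq> 0) \<and> a1 * l + b1 * m + c1 * n = 0 \<and>
      a2 * l + b2 * m + c2 * n = 0 \<and> a3 * l + b3 * m + c3 * n = 0)" (is "_ \<longleftrightarrow> ?R")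
  proof -
    have "(\<exists>x. M *v x = 0 \<and> x \<noteq> 0) \<longleftrightarrow>
        (\<exists>l m n. M *v vector [l, m, n] = 0 \<and> vector [l, m, n] \<noteq> (0 :: real^3))"
      using forall_vector_3[of "\<lambda>x. \<not> (M *v x = 0 \<and> x \<noteq> 0)"] by blast
    also have "\<dots> \<longleftrightarrow> ?R"
      by (intro ex_cong1) (auto simp: M_def vec_eq_iff forall_3 matrix_vector_mult_def sum_3)
    finally show ?thesis .
  qed
  ultimately show ?thesis
    by simp
qed

lemma conjugate_hom_iff:
  assumes "bilinear \<beta>" "u \<noteq> 0" "v \<noteq> 0"
  shows "conjugate \<beta> (hom u) (hom v) \<longleftrightarrow> \<beta> u v = 0"
  using assms
  by (auto simp: conjugate_def rays_hom span_singleton bilinear_lmul bilinear_rmul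
      dest: bspec[of _ _ 1] intro!: exI[of _ 1])

text \<open>
  For a conic through the vertices only the three mixed coefficients remain.
\<close>

lemma circumscribed_form:
  assumes "bilinear \<beta>" "\<And>u v. \<beta> u v = \<beta> v u"
    and "\<beta> (A, 1) (A, 1) = 0" "\<beta> (B, 1) (B, 1) = 0" "\<beta> (C, 1) (C, 1) = 0"
  shows "\<beta> (bary_vec A B C x y z) (bary_vec A B C x' y' z') =
    \<beta> (B, 1) (C, 1) * (y * z' + z * y') + \<beta> (C, 1) (A, 1) * (z * x' + x * z')
      + \<beta> (A, 1) (B, 1) * (x * y' + y * x')"
proof -
  have bary_vec: "bary_vec A B C x y z = x *\<^sub>R (A, 1) + y *\<^sub>R (B, 1) + z *\<^sub>R (C, 1)" for x y z
    by (simp add: bary_vec_def)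
  show ?thesis
    unfolding bary_vec bilinear_ladd[OF assms(1)] bilinear_radd[OF assms(1)]
      bilinear_lmul[OF assms(1)] bilinear_rmul[OF assms(1)] assms(3-5)
      assms(2)[of "(C, 1)" "(B, 1)"] assms(2)[of "(A, 1)" "(C, 1)"] assms(2)[of "(B, 1)" "(A, 1)"]
    by (simp add: algebra_simps)
qed

text \<open>
  A form vanishing at the vertices is given by \<open>(l, m, n)\<close>, the values at pairs of distinct vertices. The
  conic passes through \<open>(a : b : c)\<close> iff \<open>l b c + m c a + n a b = 0\<close>; a point is a pole of the line at
  infinity iff it is conjugate to two points of that line, here \<open>(0 : 1 : -1)\<close> and \<open>(-1 : 0 : 1)\<close>. A
  nonzero solution \<open>(l, m, n)\<close> of these three linear equations exists iff their determinant vanishes,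
  and the determinant is the left-hand side of the equation.
\<close>

lemma bary_in_nine_point_conic_iff:
  fixes A B C :: "real^2"
  assumes nc: "\<not> collinear {A, B, C}" and abc: "a \<noteq> 0 \<or> b \<noteq> 0 \<or> c \<noteq> 0"
    and X: "x \<noteq> 0 \<or> y \<noteq> 0 \<or> z \<noteq> 0"
  shows "bary A B C x y z \<in> nine_point_conic (ordinary A) (ordinary B) (ordinary C)
      (bary A B C a b c) line_at_infinity \<longleftrightarrow>
    b * c * (x * (y + z - x)) + c * a * (y * (z + x - y)) + a * b * (z * (x + y - z)) = 0"
    (is "?X \<in> ?N \<longleftrightarrow> ?eq")
proof -
  have nz: "bary_vec A B C x y z \<noteq> 0" if "x \<noteq> 0 \<or> y \<noteq> 0 \<or> z \<noteq> 0" for x y z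
    using that by (auto simp: bary_vec_zero_iff[OF nc])
  have vert: "(A, 1) = bary_vec A B C 1 0 0" "(B, 1) = bary_vec A B C 0 1 0" "(C, 1) = bary_vec A B C 0 0 1"
    by (simp_all add: bary_vec_def)
  \<comment> \<open>The three linear equations for the coefficients of the conic.\<close>
  define K where "K = (\<lambda>l m n. (l \<noteq> 0 \<or> m \<noteq> 0 \<or> n \<noteq> 0) \<and>
    (b * c) * l + (c * a) * m + (a * b) * n = 0 \<and> (z - y) * l + (- x) * m + x * n = 0 \<and>
    y * l + (x - z) * m + (- y) * n = 0)"
  have "?X \<in> ?N \<longleftrightarrow> (\<exists>l m n. K l m n)"
  proof
    assume "?X \<in> ?N"
    then obtain \<beta> where \<beta>: "conic_form \<beta>" and
      on: "{ordinary A, ordinary B, ordinary C, bary A B C a b c} \<subseteq> conic \<beta>" and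
      pole: "is_pole_of \<beta> ?X line_at_infinity"
      unfolding nine_point_conic_def by blast
    have bil: "bilinear \<beta>" and sym: "\<And>u v. \<beta> u v = \<beta> v u" and "\<exists>u v. \<beta> u v \<noteq> 0"
      using \<beta> unfolding conic_form_def by blast+
    have 0: "\<beta> (A, 1) (A, 1) = 0" "\<beta> (B, 1) (B, 1) = 0" "\<beta> (C, 1) (C, 1) = 0"
      and P: "\<beta> (bary_vec A B C a b c) (bary_vec A B C a b c) = 0"
      using on conjugate_hom_iff[OF bil] nz[OF abc]
      by (auto simp: conic_def ordinary_def bary_eq_hom zero_prod_def)
    define l m n where "l = \<beta> (B, 1) (C, 1)" and "m = \<beta> (C, 1) (A, 1)" and "n = \<beta> (A, 1) (B, 1)"
    have form: "\<beta> (bary_vec A B C x y z) (bary_vec A B C x' y' z') =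
        l * (y * z' + z * y') + m * (z * x' + x * z') + n * (x * y' + y * x')" for x y z x' y' z'
      unfolding l_def m_def n_def by (rule circumscribed_form[OF bil sym 0])
    have "l \<noteq> 0 \<or> m \<noteq> 0 \<or> n \<noteq> 0"
    proof (rule ccontr)
      assume "\<not> (l \<noteq> 0 \<or> m \<noteq> 0 \<or> n \<noteq> 0)"
      then have "\<beta> (bary_vec A B C x y z) (bary_vec A B C x' y' z') = 0" for x y z x' y' z'
        by (simp add: form)
      then have "\<beta> u v = 0" for u v
        using bary_coordinates[OF nc] by metis
      then show False
        using \<open>\<exists>u v. \<beta> u v \<noteq> 0\<close> by blast
    qed
    moreover have "(b * c) * l + (c * a) * m + (a * b) * n = 0"
      using P unfolding form by (simp add: algebra_simps)
    moreover have "\<beta> (bary_vec A B C x y z) (bary_vec A B C x' y' z') = 0"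
      if s: "x' + y' + z' = 0" and n: "x' \<noteq> 0 \<or> y' \<noteq> 0 \<or> z' \<noteq> 0" for x' y' z'
    proof -
      have "conjugate \<beta> ?X (bary A B C x' y' z')"
        using pole s bary_in_infinity_iff[OF nc n] unfolding is_pole_of_def by blast
      then show ?thesis
        unfolding bary_eq_hom conjugate_hom_iff[OF bil nz[OF X] nz[OF n]] .
    qed
    from this[of 0 1 "-1"] this[of "-1" 0 1]
    have "(z - y) * l + (- x) * m + x * n = 0" "y * l + (x - z) * m + (- y) * n = 0"
      unfolding form by (simp_all add: algebra_simps)
    ultimately show "\<exists>l m n. K l m n"
      unfolding K_def by blast
  next
    assume "\<exists>l m n. K l m n"
    then obtain l m n where K: "K l m n"
      by blast
    obtain f g h :: "(real^2) \<times> real \<Rightarrow> real" where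
      lin: "linear f" "linear g" "linear h" and
      f: "\<And>x y z. f (bary_vec A B C x y z) = x" and
      g: "\<And>x y z. g (bary_vec A B C x y z) = y" and
      h: "\<And>x y z. h (bary_vec A B C x y z) = z"
      using bary_coordinates[OF nc] by metis
    define \<beta> where "\<beta> = (\<lambda>u v. l * (g u * h v + h u * g v) + m * (h u * f v + f u * h v)
      + n * (f u * g v + g u * f v))"
    have form: "\<beta> (bary_vec A B C x y z) (bary_vec A B C x' y' z') =
        l * (y * z' + z * y') + m * (z * x' + x * z') + n * (x * y' + y * x')" for x y z x' y' z'
      by (simp add: \<beta>_def f g h)
    have bil: "bilinear \<beta>"
      unfolding bilinear_def \<beta>_def using lin by (auto simp: linear_iff algebra_simps)
    have "conic_form \<beta>"
      unfolding conic_form_def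
    proof (intro conjI allI bil)
      show "\<beta> u v = \<beta> v u" for u v
        by (simp add: \<beta>_def algebra_simps)
      have "\<beta> (B, 1) (C, 1) = l" "\<beta> (C, 1) (A, 1) = m" "\<beta> (A, 1) (B, 1) = n"
        unfolding vert form by simp_all
      then show "\<exists>u v. \<beta> u v \<noteq> 0"
        using K unfolding K_def by metis
    qed
    moreover have "{ordinary A, ordinary B, ordinary C, bary A B C a b c} \<subseteq> conic \<beta>"
    proof -
      have "\<beta> (bary_vec A B C a b c) (bary_vec A B C a b c) = 2 * ((b * c) * l + (c * a) * m + (a * b) * n)"
        unfolding form by (simp add: algebra_simps)
      then have "\<beta> (bary_vec A B C a b c) (bary_vec A B C a b c) = 0"
        using K unfolding K_def by simp
      moreover have "\<beta> (A, 1) (A, 1) = 0" "\<beta> (B, 1) (B, 1) = 0" "\<beta> (C, 1) (C, 1) = 0"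
        unfolding vert form by simp_all
      ultimately show ?thesis
        using nz[OF abc] conjugate_hom_iff[OF bil]
        by (simp add: conic_def ordinary_def bary_eq_hom zero_prod_def)
    qed
    moreover have "is_pole_of \<beta> ?X line_at_infinity"
      unfolding is_pole_of_def
    proof
      fix Y
      assume Y: "Y \<in> line_at_infinity"
      obtain x' y' z' where n: "x' \<noteq> 0 \<or> y' \<noteq> 0 \<or> z' \<noteq> 0" and Y': "Y = bary A B C x' y' z'"
        using bary_cases[OF nc] .
      have z': "z' = - x' - y'"
        using Y bary_in_infinity_iff[OF nc n] unfolding Y' by simp
      have "\<beta> (bary_vec A B C x y z) (bary_vec A B C x' y' z') =
          y' * ((z - y) * l + (- x) * m + x * n) - x' * (y * l + (x - z) * m + (- y) * n)"
        unfolding form z' by (simp add: algebra_simps)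
      then have "\<beta> (bary_vec A B C x y z) (bary_vec A B C x' y' z') = 0"
        using K unfolding K_def by simp
      then show "conjugate \<beta> ?X Y"
        unfolding Y' bary_eq_hom conjugate_hom_iff[OF bil nz[OF X] nz[OF n]] .
    qed
    ultimately show "?X \<in> ?N"
      unfolding nine_point_conic_def by blast
  qed
  also have "\<dots> \<longleftrightarrow> ?eq"
    unfolding K_def homogeneous_system_3_iff by (simp add: algebra_simps)
  finally show ?thesis .
qed

section \<open>The circumconic\<close>

text \<open>
  The map takes \<open>A\<close>, \<open>B\<close>, \<open>C\<close> to the feet \<open>(0 : b : c)\<close>, \<open>(a : 0 : c)\<close>, \<open>(a : b : 0)\<close>, normalized by their
  coordinate sums, and this determines it.
\<close>

lemma cevian_map_bary:
  fixes A B C :: "real^2"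
  assumes nc: "\<not> collinear {A, B, C}" and abc: "a \<noteq> 0" "b \<noteq> 0" "c \<noteq> 0"
    and uvw: "b + c \<noteq> 0" "c + a \<noteq> 0" "a + b \<noteq> 0" and X: "x \<noteq> 0 \<or> y \<noteq> 0 \<or> z \<noteq> 0"
  shows "affine_ext (cevian_map A B C (bary A B C a b c)) (bary A B C x y z) =
    bary A B C (a * (y / (c + a) + z / (a + b))) (b * (x / (b + c) + z / (a + b)))
      (c * (x / (b + c) + y / (c + a)))"
proof -
  have nc2: "\<not> collinear {B, C, A}" and nc3: "\<not> collinear {C, A, B}"
    using nc noncollinear_rotate by blast+
  have D: "cevian_foot A B C (bary A B C a b c) = bary A B C 0 b c"
    using cevian_foot_bary[OF nc, of b c a] abc by simp
  have E: "cevian_foot B C A (bary A B C a b c) = bary A B C a 0 c"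
    using cevian_foot_bary[OF nc2, of c a b] abc by (simp add: bary_rotate[of B C A])
  have F: "cevian_foot C A B (bary A B C a b c) = bary A B C a b 0"
    using cevian_foot_bary[OF nc3, of a b c] abc
    by (simp add: bary_rotate[of B C A] bary_rotate[of C A B])
  define D' E' F' where "D' = (b / (b + c)) *\<^sub>R B + (c / (b + c)) *\<^sub>R C"
    and "E' = (a / (c + a)) *\<^sub>R A + (c / (c + a)) *\<^sub>R C"
    and "F' = (a / (a + b)) *\<^sub>R A + (b / (a + b)) *\<^sub>R B"
  have feet: "ordinary D' = bary A B C 0 b c" "ordinary E' = bary A B C a 0 c"
    "ordinary F' = bary A B C a b 0"
    using ordinary_affine_combination[of 0 "b / (b + c)" "c / (b + c)" A B C]
      ordinary_affine_combination[of "a / (c + a)" 0 "c / (c + a)" A B C]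
      ordinary_affine_combination[of "a / (a + b)" "b / (a + b)" 0 A B C]
      bary_scale[of "1 / (b + c)" A B C 0 b c] bary_scale[of "1 / (c + a)" A B C a 0 c]
      bary_scale[of "1 / (a + b)" A B C a b 0] uvw
    by (simp_all add: D'_def E'_def F'_def add.commute flip: add_divide_distrib)
  obtain f where f: "affine_map f" "f A = D'" "f B = E'" "f C = F'"
    using affine_map_exists[OF nc] .
  have "cevian_map A B C (bary A B C a b c) = f"
    unfolding cevian_map_def D E F
  proof (rule the_equality)
    show "affine_map f \<and> ordinary (f A) = bary A B C 0 b c \<and>
        ordinary (f B) = bary A B C a 0 c \<and> ordinary (f C) = bary A B C a b 0"
      using f feet by simp
  next
    fix g
    assume g: "affine_map g \<and> ordinary (g A) = bary A B C 0 b c \<and>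
        ordinary (g B) = bary A B C a 0 c \<and> ordinary (g C) = bary A B C a b 0"
    then have "g A = f A" "g B = f B" "g C = f C"
      using f feet by (metis ordinary_inject)+
    then show "g = f"
      using g by (intro affine_map_eqI[OF nc f(1)]) (simp add: affine_map_combination)
  qed
  then have "affine_ext (cevian_map A B C (bary A B C a b c)) (bary A B C x y z) = bary D' E' F' x y z"
    using affine_ext_bary[OF nc f(1) X] f by simp
  also have "\<dots> = bary A B C (a * (y / (c + a) + z / (a + b))) (b * (x / (b + c) + z / (a + b)))
      (c * (x / (b + c) + y / (c + a)))"
  proof -
    have "x *\<^sub>R D' + y *\<^sub>R E' + z *\<^sub>R F' =
        (a * (y / (c + a) + z / (a + b))) *\<^sub>R A + (b * (x / (b + c) + z / (a + b))) *\<^sub>R B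
          + (c * (x / (b + c) + y / (c + a))) *\<^sub>R C"
      by (simp add: D'_def E'_def F'_def algebra_simps)
    moreover have "x + y + z = a * (y / (c + a) + z / (a + b)) + b * (x / (b + c) + z / (a + b))
        + c * (x / (b + c) + y / (c + a))"
    proof -
      have "x = (b + c) * (x / (b + c))" "y = (c + a) * (y / (c + a))" "z = (a + b) * (z / (a + b))"
        using uvw by simp_all
      then show ?thesis
        by algebra
    qed
    ultimately show ?thesis
      unfolding bary_def by (simp only:)
  qed
  finally show ?thesis .
qed

text \<open>
  In the variables \<open>r = x/u\<close>, \<open>s = y/v\<close>, \<open>t = z/w\<close>, with \<open>u = b + c\<close>, \<open>v = c + a\<close>, \<open>w = a + b\<close>, the affine map
  becomes \<open>(r, s, t) \<mapsto> (a (s + t) : b (r + t) : c (r + s))\<close>, and the equation of the nine-point conic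
  pulls back to \<open>2 a b c (u s t + v t r + w r s) = 0\<close>.
\<close>

lemma bary_in_circumconic_O_iff:
  fixes A B C :: "real^2"
  assumes nc: "\<not> collinear {A, B, C}" and abc: "a \<noteq> 0" "b \<noteq> 0" "c \<noteq> 0"
    and uvw: "b + c \<noteq> 0" "c + a \<noteq> 0" "a + b \<noteq> 0" and X: "x \<noteq> 0 \<or> y \<noteq> 0 \<or> z \<noteq> 0"
  shows "bary A B C x y z \<in> circumconic_O A B C (bary A B C (1/a) (1/b) (1/c)) \<longleftrightarrow>
    (b + c)\<^sup>2 * (y * z) + (c + a)\<^sup>2 * (z * x) + (a + b)\<^sup>2 * (x * y) = 0"
proof -
  define u v w where "u = b + c" and "v = c + a" and "w = a + b"
  have nz: "u \<noteq> 0" "v \<noteq> 0" "w \<noteq> 0"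
    using uvw by (simp_all add: u_def v_def w_def)
  define r s t where "r = x / u" and "s = y / v" and "t = z / w"
  have xyz: "x = u * r" "y = v * s" "z = w * t"
    using nz by (simp_all add: r_def s_def t_def)
  have image_nz: "a * (s + t) \<noteq> 0 \<or> b * (r + t) \<noteq> 0 \<or> c * (r + s) \<noteq> 0"
    using X abc unfolding xyz by auto
  have "bary A B C x y z \<in> circumconic_O A B C (bary A B C (1/a) (1/b) (1/c)) \<longleftrightarrow>
      bary A B C (a * (s + t)) (b * (r + t)) (c * (r + s)) \<in>
        nine_point_conic (ordinary A) (ordinary B) (ordinary C) (bary A B C a b c) line_at_infinity"
    unfolding circumconic_O_def Let_def isotomic_bary[OF nc abc] vimage_eq
      cevian_map_bary[OF nc abc uvw X] r_def s_def t_def u_def v_def w_def by (rule refl)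
  also have "\<dots> \<longleftrightarrow>
      b * c * (a * (s + t) * (b * (r + t) + c * (r + s) - a * (s + t))) +
      c * a * (b * (r + t) * (c * (r + s) + a * (s + t) - b * (r + t))) +
      a * b * (c * (r + s) * (a * (s + t) + b * (r + t) - c * (r + s))) = 0"
    using bary_in_nine_point_conic_iff[OF nc _ image_nz] abc by blast
  also have "\<dots> \<longleftrightarrow> 2 * (a * b * c) * (u * (s * t) + v * (t * r) + w * (r * s)) = 0"
    unfolding u_def v_def w_def by (simp add: algebra_simps)
  also have "\<dots> \<longleftrightarrow> u * v * w * (u * (s * t) + v * (t * r) + w * (r * s)) = 0"
    using abc nz by simp
  also have "\<dots> \<longleftrightarrow> u\<^sup>2 * (y * z) + v\<^sup>2 * (z * x) + w\<^sup>2 * (x * y) = 0"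
    unfolding xyz by (simp add: algebra_simps power2_eq_square)
  finally show ?thesis
    unfolding u_def v_def w_def .
qed

text \<open>
  The coordinates \<open>(p : q : r)\<close> of \<open>P\<close> are nonzero off the sides, and the sums \<open>q + r\<close>, \<open>r + p\<close>, \<open>p + q\<close> are
  nonzero off the sides of the anticomplementary triangle. Passing to reciprocals keeps both
  properties, since \<open>1/q + 1/r = (q + r) / (q r)\<close>.
\<close>

lemma admissible_point_cases:
  fixes A B C :: "real^2"
  assumes nc: "\<not> collinear {A, B, C}" and "P \<notin> on_sides A B C"
    and "P \<notin> on_sides_anticomplementary A B C"
  obtains a b c where "a \<noteq> 0" "b \<noteq> 0" "c \<noteq> 0" "b + c \<noteq> 0" "c + a \<noteq> 0" "a + b \<noteq> 0"
    "P = bary A B C (1/a) (1/b) (1/c)"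
proof -
  have nc2: "\<not> collinear {B, C, A}" and nc3: "\<not> collinear {C, A, B}"
    using nc noncollinear_rotate by blast+
  obtain p q r where n: "p \<noteq> 0 \<or> q \<noteq> 0 \<or> r \<noteq> 0" and P: "P = bary A B C p q r"
    using bary_cases[OF nc] .
  have n2: "q \<noteq> 0 \<or> r \<noteq> 0 \<or> p \<noteq> 0" and n3: "r \<noteq> 0 \<or> p \<noteq> 0 \<or> q \<noteq> 0"
    using n by blast+
  have P2: "P = bary B C A q r p" and P3: "P = bary C A B r p q"
    unfolding P by (simp_all only: bary_rotate[of B C A] bary_rotate[of C A B])
  have pqr: "p \<noteq> 0" "q \<noteq> 0" "r \<noteq> 0"
    using assms(2) bary_in_side_iff[OF nc n] bary_in_side_iff[OF nc2 n2] bary_in_side_iff[OF nc3 n3]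
    unfolding on_sides_def P[symmetric] P2[symmetric] P3[symmetric] by blast+
  have sums: "q + r \<noteq> 0" "r + p \<noteq> 0" "p + q \<noteq> 0"
    using assms(3) on_anticomplementary_side[OF nc n] on_anticomplementary_side[OF nc2 n2]
      on_anticomplementary_side[OF nc3 n3] on_sides_anticomplementary_rotate[of A B C]
      on_sides_anticomplementary_rotate[of B C A]
    unfolding P[symmetric] P2[symmetric] P3[symmetric] by auto
  show ?thesis
  proof (rule that[of "1 / p" "1 / q" "1 / r"])
    show "1/q + 1/r \<noteq> 0" "1/r + 1/p \<noteq> 0" "1/p + 1/q \<noteq> 0"
      using pqr sums by (simp_all add: add_frac_eq add.commute)
  qed (simp_all add: pqr P)
qed

theorem proposition3p5:
  fixes A B C :: "real^2" and P :: ppoint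
  assumes "\<not> collinear {A, B, C}"
    and "P \<notin> on_sides A B C"
    and "P \<notin> on_sides_anticomplementary A B C"
  shows "gen_isogonal A B C P ` line_at_infinity = circumconic_O A B C P"
proof -
  note nc = assms(1)
  obtain a b c where abc: "a \<noteq> 0" "b \<noteq> 0" "c \<noteq> 0" and uvw: "b + c \<noteq> 0" "c + a \<noteq> 0" "a + b \<noteq> 0"
    and P: "P = bary A B C (1/a) (1/b) (1/c)"
    using admissible_point_cases[OF assms] .
  define u v w where "u = (b + c)\<^sup>2" and "v = (c + a)\<^sup>2" and "w = (a + b)\<^sup>2"
  have nz: "u \<noteq> 0" "v \<noteq> 0" "w \<noteq> 0"
    using uvw by (simp_all add: u_def v_def w_def)
  have gamma: "gen_isogonal A B C P (bary A B C x y z) = bary A B C (u * (y * z)) (v * (z * x)) (w * (x * y))"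
    if "x + y + z = 0" "x \<noteq> 0 \<or> y \<noteq> 0 \<or> z \<noteq> 0" for x y z
    unfolding P u_def v_def w_def by (rule gen_isogonal_infinity[OF nc abc uvw that])
  have circumconic: "bary A B C x y z \<in> circumconic_O A B C P \<longleftrightarrow>
      u * (y * z) + v * (z * x) + w * (x * y) = 0" if "x \<noteq> 0 \<or> y \<noteq> 0 \<or> z \<noteq> 0" for x y z
    unfolding P u_def v_def w_def by (rule bary_in_circumconic_O_iff[OF nc abc uvw that])
  show ?thesis
  proof (intro equalityI subsetI)
    fix Y
    assume "Y \<in> gen_isogonal A B C P ` line_at_infinity"
    then obtain X where X: "X \<in> line_at_infinity" and Y: "Y = gen_isogonal A B C P X"
      by blast
    obtain x y z where n: "x \<noteq> 0 \<or> y \<noteq> 0 \<or> z \<noteq> 0" and X': "X = bary A B C x y z"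
      using bary_cases[OF nc] .
    have s: "x + y + z = 0"
      using X bary_in_infinity_iff[OF nc n] unfolding X' by simp
    have image_nz: "u * (y * z) \<noteq> 0 \<or> v * (z * x) \<noteq> 0 \<or> w * (x * y) \<noteq> 0"
      using n s nz by auto
    have "u * ((v * (z * x)) * (w * (x * y))) + v * ((w * (x * y)) * (u * (y * z)))
        + w * ((u * (y * z)) * (v * (z * x))) = u * v * w * (x * y * z) * (x + y + z)"
      by (simp add: algebra_simps)
    then show "Y \<in> circumconic_O A B C P"
      unfolding Y X' gamma[OF s n] circumconic[OF image_nz] using s by simp
  next
    fix Y
    assume Y: "Y \<in> circumconic_O A B C P"
    obtain x y z where n: "x \<noteq> 0 \<or> y \<noteq> 0 \<or> z \<noteq> 0" and Y': "Y = bary A B C x y z"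
      using bary_cases[OF nc] .
    have eq: "u * (y * z) + v * (z * x) + w * (x * y) = 0"
      using Y circumconic[OF n] unfolding Y' by simp
    \<comment> \<open>A preimage is needed only up to the common factor \<open>k\<close> of the homogeneous coordinates.\<close>
    have image: "Y \<in> gen_isogonal A B C P ` line_at_infinity"
      if s: "x' + y' + z' = 0" and n': "x' \<noteq> 0 \<or> y' \<noteq> 0 \<or> z' \<noteq> 0"
        and k: "k \<noteq> 0" "u * (y' * z') = k * x" "v * (z' * x') = k * y" "w * (x' * y') = k * z"
      for x' y' z' k
    proof (rule image_eqI)
      show "Y = gen_isogonal A B C P (bary A B C x' y' z')"
        unfolding gamma[OF s n'] k Y' bary_scale[OF k(1)] by (rule refl)
      show "bary A B C x' y' z' \<in> line_at_infinity"
        using s bary_in_infinity_iff[OF nc n'] by simp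
    qed
    \<comment> \<open>A point of the circumconic on a side is a vertex.\<close>
    have "(x \<noteq> 0 \<and> y \<noteq> 0 \<and> z \<noteq> 0) \<or> (x \<noteq> 0 \<and> y = 0 \<and> z = 0) \<or> (x = 0 \<and> y \<noteq> 0 \<and> z = 0)
        \<or> (x = 0 \<and> y = 0 \<and> z \<noteq> 0)"
      using n eq nz by auto
    then consider "x \<noteq> 0" "y \<noteq> 0" "z \<noteq> 0" | "x \<noteq> 0" "y = 0" "z = 0" | "x = 0" "y \<noteq> 0" "z = 0"
      | "x = 0" "y = 0" "z \<noteq> 0"
      by blast
    then show "Y \<in> gen_isogonal A B C P ` line_at_infinity"
    proof cases
      \<comment> \<open>The map is its own inverse; the equation of the conic says that the preimage is infinite.\<close>
      case 1
      then show ?thesis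
        using nz eq
        by (intro image[of "u * (y * z)" "v * (z * x)" "w * (x * y)" "u * v * w * (x * y * z)"])
          (auto simp: algebra_simps)
    next
      \<comment> \<open>The vertex \<open>A\<close> is the image of the infinite point of \<open>BC\<close>, and similarly for \<open>B\<close> and \<open>C\<close>.\<close>
      case 2
      then show ?thesis
        using nz by (intro image[of 0 1 "-1" "- u / x"]) auto
    next
      case 3
      then show ?thesis
        using nz by (intro image[of 1 0 "-1" "- v / y"]) auto
    next
      case 4
      then show ?thesis
        using nz by (intro image[of 1 "-1" 0 "- w / z"]) auto
    qed
  qed
qed

end
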